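(* Let $H$ be a complex Hilbert space and let $T \colon \mathcal{L}(H) \to \mathcal{L}(H)$ be a positive and unital linear operator. Assume that $T$ has a pre-adjoint $T_*$ acting on the space $\mathcal{L}^1(H)$ of trace class operators and assume that there exists an injective positive trace class operator $b \in \mathcal{L}^1(H)_+$ that satisfies $T_* b \le b$. Then the following are equivalent: (a) The inverse operator $T^{-1}$ exists and is positive. (b) The operator $T$ is a bijective isometry. (c) The operator $T$ is doubly power bounded.
   Context: $\mathcal{L}(H)$ is the $C^*$-algebra of all bounded linear operators on $H$ and $\mathcal{L}^1(H)$ is the space of trace class operators on $H$ with the trace norm, whose dual is $\mathcal{L}(H)$ via the trace pairing $(a,x)\mapsto \mathrm{tr}(ax)$. A pre-adjoint of $T$ is a bounded linear operator $T_*$ on $\mathcal{L}^1(H)$ whose Banach space adjoint is $T$, i.e. $\mathrm{tr}((T_*a)x) = \mathrm{tr}(a\,Tx)$ for all $a \in \mathcal{L}^1(H)$, $x \in \mathcal{L}(H)$. $T$ is positive if it maps positive operators to positive operators, and unital if $T\mathbf{1}=\mathbf{1}$. Order relations are with respect to the usual order of self-adjoint operators. A bounded linear operator $T$ on a Banach space is doubly power bounded if it is bijective and $\sup_{n \in \mathbb{Z}} \|T^n\| < \infty$. *)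

theory Defs
  imports "HOL-Analysis.Analysis"
begin

section \<open>Complex Hilbert spaces\<close>

class scaleC =
  fixes scaleC :: "complex \<Rightarrow> 'a \<Rightarrow> 'a"  (infixr "*\<^sub>C" 75)

class complex_vector = real_vector + scaleC +
  assumes scaleC_add_right: "c *\<^sub>C (x + y) = c *\<^sub>C x + c *\<^sub>C y"
    and scaleC_add_left: "(c + d) *\<^sub>C x = c *\<^sub>C x + d *\<^sub>C x"
    and scaleC_scaleC: "c *\<^sub>C d *\<^sub>C x = (c * d) *\<^sub>C x"
    and scaleR_scaleC: "r *\<^sub>R x = complex_of_real r *\<^sub>C x"

abbreviation clinear :: "('a::complex_vector \<Rightarrow> 'b::complex_vector) \<Rightarrow> bool"
  where "clinear \<equiv> Vector_Spaces.linear scaleC scaleC"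

lemma vector_space_scaleC: "vector_space (scaleC :: complex \<Rightarrow> 'a \<Rightarrow> 'a::complex_vector)"
proof
  show "1 *\<^sub>C x = x" for x :: 'a
    using scaleR_scaleC[of 1 x] by simp
qed (simp_all add: scaleC_add_right scaleC_add_left scaleC_scaleC)

lemma clinear_iff:
  "clinear f \<longleftrightarrow> (\<forall>x y. f (x + y) = f x + f y) \<and> (\<forall>c x. f (c *\<^sub>C x) = c *\<^sub>C f x)"
  by (simp add: Vector_Spaces.linear_iff vector_space_scaleC)

lemma scaleC_zero [simp]: "c *\<^sub>C (0::'a::complex_vector) = 0"
  using scaleC_add_right[of c 0 0] by simp

lemma scaleC_minus_right: "c *\<^sub>C (- x) = - (c *\<^sub>C (x::'a::complex_vector))"
  using scaleC_add_right[of c x "- x"] by (simp add: eq_neg_iff_add_eq_0 add.commute)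

lemma scaleC_diff_right: "c *\<^sub>C (x - y) = c *\<^sub>C x - c *\<^sub>C (y::'a::complex_vector)"
  using scaleC_add_right[of c x "- y"] by (simp add: scaleC_minus_right)

text \<open>
  The complex inner product is linear in the first argument. The norm and the topology come
  from \<open>real_inner\<close>; the last axiom says that its real inner product is the real part of the
  complex one, so that the norm of \<open>x\<close> is the square root of \<open>cinner x x\<close>.
\<close>

class complex_hilbert_space = complex_vector + real_inner + complete_space +
  fixes cinner :: "'a \<Rightarrow> 'a \<Rightarrow> complex"
  assumes cinner_add_left: "cinner (x + y) z = cinner x z + cinner y z"
    and cinner_scaleC_left: "cinner (c *\<^sub>C x) y = c * cinner x y"
    and cinner_commute: "cinner x y = cnj (cinner y x)"
    and Re_cinner: "Re (cinner x y) = x \<bullet> y"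


section \<open>Bounded linear operators\<close>

typedef (overloaded) 'a bop =
  "{f :: 'a::complex_hilbert_space \<Rightarrow> 'a. clinear f \<and> bounded_linear f}"
  morphisms app Bop
proof
  show "(\<lambda>_. 0) \<in> {f :: 'a \<Rightarrow> 'a. clinear f \<and> bounded_linear f}"
    by (simp add: clinear_iff)
qed

setup_lifting type_definition_bop

lemma bounded_linear_scaleC:
  "bounded_linear (scaleC c :: 'a \<Rightarrow> 'a::complex_hilbert_space)"
proof (rule bounded_linear_intro)
  fix x y :: 'a and r :: real
  show "c *\<^sub>C (x + y) = c *\<^sub>C x + c *\<^sub>C y" by (rule scaleC_add_right)
  show "c *\<^sub>C r *\<^sub>R x = r *\<^sub>R c *\<^sub>C x"
    by (simp add: scaleR_scaleC scaleC_scaleC mult.commute)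
  have "cinner (c *\<^sub>C x) (c *\<^sub>C x) = (c * cnj c) * cinner x x"
    by (simp add: cinner_scaleC_left)
       (subst cinner_commute, simp add: cinner_scaleC_left, metis cinner_commute)
  then have "(norm (c *\<^sub>C x))\<^sup>2 = (cmod c * norm x)\<^sup>2"
    by (simp add: power2_norm_eq_inner Re_cinner[symmetric] power_mult_distrib
        complex_norm_square[symmetric] del: of_real_power)
  then show "norm (c *\<^sub>C x) \<le> norm x * cmod c"
    by (simp add: mult.commute)
qed

text \<open>The algebra structure: the product is composition, the norm is the operator norm.\<close>

instantiation bop :: (complex_hilbert_space) "{ring, monoid_mult}"
begin

lift_definition zero_bop :: "'a bop" is "\<lambda>_. 0" by (simp add: clinear_iff)

lift_definition plus_bop :: "'a bop \<Rightarrow> 'a bop \<Rightarrow> 'a bop" is "\<lambda>f g x. f x + g x"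
  by (auto simp: clinear_iff scaleC_add_right intro: bounded_linear_add)

lift_definition uminus_bop :: "'a bop \<Rightarrow> 'a bop" is "\<lambda>f x. - f x"
  by (auto simp: clinear_iff scaleC_minus_right intro: bounded_linear_minus)

lift_definition minus_bop :: "'a bop \<Rightarrow> 'a bop \<Rightarrow> 'a bop" is "\<lambda>f g x. f x - g x"
  by (auto simp: clinear_iff scaleC_diff_right intro: bounded_linear_sub)

lift_definition one_bop :: "'a bop" is "\<lambda>x. x" by (simp add: clinear_iff)

lift_definition times_bop :: "'a bop \<Rightarrow> 'a bop \<Rightarrow> 'a bop" is "\<lambda>f g x. f (g x)"
  by (auto simp: clinear_iff intro: bounded_linear_compose)

instance
  by standard (transfer; simp add: clinear_iff algebra_simps fun_eq_iff)+

end

instantiation bop :: (complex_hilbert_space) "{complex_vector, real_normed_vector}"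
begin

lift_definition scaleC_bop :: "complex \<Rightarrow> 'a bop \<Rightarrow> 'a bop" is "\<lambda>c f x. c *\<^sub>C f x"
  by (auto simp: clinear_iff scaleC_add_right scaleC_scaleC mult.commute
      intro: bounded_linear_compose[OF bounded_linear_scaleC])

definition scaleR_bop :: "real \<Rightarrow> 'a bop \<Rightarrow> 'a bop"
  where "scaleR_bop r a = complex_of_real r *\<^sub>C a"

lift_definition norm_bop :: "'a bop \<Rightarrow> real" is onorm .

definition sgn_bop :: "'a bop \<Rightarrow> 'a bop"
  where "sgn_bop a = inverse (norm a) *\<^sub>R a"

definition dist_bop :: "'a bop \<Rightarrow> 'a bop \<Rightarrow> real"
  where "dist_bop a b = norm (a - b)"

definition uniformity_bop :: "('a bop \<times> 'a bop) filter"
  where "uniformity_bop = (INF e\<in>{0 <..}. principal {(x, y). dist x y < e})"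

definition open_bop :: "'a bop set \<Rightarrow> bool"
  where "open_bop U = (\<forall>x\<in>U. \<forall>\<^sub>F (x', y) in uniformity. x' = x \<longrightarrow> y \<in> U)"

instance
proof
  fix a b :: "'a bop" and c d :: complex and r s :: real
  show C1: "c *\<^sub>C (a + b) = c *\<^sub>C a + c *\<^sub>C b" for c and a b :: "'a bop"
    by transfer (simp add: scaleC_add_right)
  show C2: "(c + d) *\<^sub>C a = c *\<^sub>C a + d *\<^sub>C a" for c d and a :: "'a bop"
    by transfer (simp add: scaleC_add_left)
  show C3: "c *\<^sub>C d *\<^sub>C a = (c * d) *\<^sub>C a" for c d and a :: "'a bop"
    by transfer (simp add: scaleC_scaleC)
  show "r *\<^sub>R a = complex_of_real r *\<^sub>C a"
    by (rule scaleR_bop_def)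
  show "r *\<^sub>R (a + b) = r *\<^sub>R a + r *\<^sub>R b" "(r + s) *\<^sub>R a = r *\<^sub>R a + s *\<^sub>R a"
    "r *\<^sub>R s *\<^sub>R a = (r * s) *\<^sub>R a"
    by (simp_all add: scaleR_bop_def C1 C2 C3)
  show "1 *\<^sub>R a = a"
    unfolding scaleR_bop_def by transfer (simp add: scaleR_scaleC[symmetric] del: of_real_1)
  show "norm a = 0 \<longleftrightarrow> a = 0"
    by transfer (auto simp: onorm_eq_0 fun_eq_iff)
  show "norm (a + b) \<le> norm a + norm b"
    by transfer (simp add: onorm_triangle)
  show "norm (r *\<^sub>R a) = \<bar>r\<bar> * norm a"
    unfolding scaleR_bop_def by transfer (simp add: scaleR_scaleC[symmetric] onorm_scaleR)
qed (simp_all add: sgn_bop_def dist_bop_def uniformity_bop_def open_bop_def)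

end

lemma cinner_add_right: "cinner x (y + z) = cinner x y + cinner x (z::'a::complex_hilbert_space)"
  by (metis cinner_add_left cinner_commute complex_cnj_add)

lemma cinner_zero_left [simp]: "cinner 0 (x::'a::complex_hilbert_space) = 0"
  using cinner_add_left[of 0 0 x] by simp

lemma cinner_zero_right [simp]: "cinner (x::'a::complex_hilbert_space) 0 = 0"
  using cinner_add_right[of x 0 0] by simp

text \<open>
  \<open>a \<le> b\<close> means that \<open>b - a\<close> is positive, that is, self-adjoint with nonnegative quadratic form;
  in particular the positive operators are those with \<open>0 \<le> a\<close>.
\<close>

instantiation bop :: (complex_hilbert_space) ordered_ab_group_add
begin

lift_definition less_eq_bop :: "'a bop \<Rightarrow> 'a bop \<Rightarrow> bool" is
  "\<lambda>f g. (\<forall>x y. cinner (g x - f x) y = cinner x (g y - f y)) \<and>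
         (\<forall>x. 0 \<le> Re (cinner (g x - f x) x))" .

definition less_bop :: "'a bop \<Rightarrow> 'a bop \<Rightarrow> bool"
  where "less_bop a b \<longleftrightarrow> a \<le> b \<and> \<not> b \<le> a"

instance
proof
  fix a b c :: "'a bop"
  show "a < b \<longleftrightarrow> a \<le> b \<and> \<not> b \<le> a" by (rule less_bop_def)
  show "a \<le> a"
    by transfer simp
  show "a \<le> c" if "a \<le> b" "b \<le> c"
    using that
  proof transfer
    fix f g h :: "'a \<Rightarrow> 'a"
    assume fg: "(\<forall>x y. cinner (g x - f x) y = cinner x (g y - f y)) \<and> (\<forall>x. 0 \<le> Re (cinner (g x - f x) x))"
      and gh: "(\<forall>x y. cinner (h x - g x) y = cinner x (h y - g y)) \<and> (\<forall>x. 0 \<le> Re (cinner (h x - g x) x))"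
    have "cinner (h x - f x) y = cinner (g x - f x) y + cinner (h x - g x) y"
      "cinner x (h y - f y) = cinner x (g y - f y) + cinner x (h y - g y)" for x y
      using cinner_add_left[of "g x - f x" "h x - g x" y]
        cinner_add_right[of x "g y - f y" "h y - g y"] by simp_all
    note sum = this
    show "(\<forall>x y. cinner (h x - f x) y = cinner x (h y - f y)) \<and> (\<forall>x. 0 \<le> Re (cinner (h x - f x) x))"
    proof (intro conjI allI)
      show "cinner (h x - f x) y = cinner x (h y - f y)" for x y
        unfolding sum using fg gh by (simp only:)
      show "0 \<le> Re (cinner (h x - f x) x)" for x
        unfolding sum plus_complex.sel using fg gh by (intro add_nonneg_nonneg) blast+
    qed
  qed
  show "c + a \<le> c + b" if "a \<le> b"
    using that by transfer (unfold add_diff_cancel_left)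
  show "a = b" if "a \<le> b" "b \<le> a"
    using that
  proof transfer
    fix f g :: "'a \<Rightarrow> 'a"
    assume lin: "clinear f \<and> bounded_linear f" "clinear g \<and> bounded_linear g"
      and fg: "(\<forall>x y. cinner (g x - f x) y = cinner x (g y - f y)) \<and> (\<forall>x. 0 \<le> Re (cinner (g x - f x) x))"
      and gf: "(\<forall>x y. cinner (f x - g x) y = cinner x (f y - g y)) \<and> (\<forall>x. 0 \<le> Re (cinner (f x - g x) x))"
    define h where "h x = g x - f x" for x
    have add: "h (x + y) = h x + h y" for x y
      using lin by (simp add: h_def clinear_iff)
    have sym: "h x \<bullet> y = h y \<bullet> x" for x y
    proof -
      have "Re (cinner (h x) y) = Re (cinner x (h y))" using fg by (simp only: h_def)
      then show ?thesis by (simp only: Re_cinner inner_commute)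
    qed
    have quad: "h x \<bullet> x = 0" for x
    proof (rule antisym)
      show "0 \<le> h x \<bullet> x" using fg by (simp add: h_def Re_cinner)
      have "0 \<le> (f x - g x) \<bullet> x" using gf by (simp add: Re_cinner)
      then show "h x \<bullet> x \<le> 0" by (simp add: h_def inner_diff_left)
    qed
    have zero: "h x \<bullet> y = 0" for x y
      using quad[of "x + y"] quad[of x] quad[of y] sym[of x y]
      by (simp add: add inner_add_left inner_add_right)
    have "h x = 0" for x
      using zero[of x "h x"] by (simp only: inner_eq_zero_iff)
    then show "f = g" by (simp add: h_def fun_eq_iff)
  qed
qed

end

definition adj :: "'a::complex_hilbert_space bop \<Rightarrow> 'a bop"
  where "adj a = (THE b. \<forall>x y. cinner (app a x) y = cinner x (app b y))"

text \<open>The absolute value is the positive square root of \<open>adj a * a\<close>.\<close>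

definition abs_bop :: "'a::complex_hilbert_space bop \<Rightarrow> 'a bop"
  where "abs_bop a = (THE s. 0 \<le> s \<and> s * s = adj a * a)"


section \<open>Trace class operators\<close>

definition orthonormal :: "'a::complex_hilbert_space set \<Rightarrow> bool"
  where "orthonormal E \<longleftrightarrow> (\<forall>e\<in>E. \<forall>f\<in>E. cinner e f = (if e = f then 1 else 0))"

text \<open>An orthonormal basis is a maximal orthonormal set.\<close>

definition orthonormal_basis :: "'a::complex_hilbert_space set \<Rightarrow> bool"
  where "orthonormal_basis E \<longleftrightarrow>
    orthonormal E \<and> (\<forall>F. orthonormal F \<and> E \<subseteq> F \<longrightarrow> F = E)"

definition trace_class :: "'a::complex_hilbert_space bop set"
  where "trace_class =
    {a. \<exists>E. orthonormal_basis E \<and> (\<lambda>e. Re (cinner (app (abs_bop a) e) e)) summable_on E}"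

text \<open>
  For trace class operators the sums below do not depend on the orthonormal basis, so they are
  taken over a fixed arbitrary one.
\<close>

definition some_onb :: "'a::complex_hilbert_space set"
  where "some_onb = (SOME E. orthonormal_basis E)"

definition tr :: "'a::complex_hilbert_space bop \<Rightarrow> complex"
  where "tr a = (\<Sum>\<^sub>\<infinity>e\<in>some_onb. cinner (app a e) e)"

definition trace_norm :: "'a::complex_hilbert_space bop \<Rightarrow> real"
  where "trace_norm a = (\<Sum>\<^sub>\<infinity>e\<in>some_onb. Re (cinner (app (abs_bop a) e) e))"

text \<open>
  \<open>S\<close> is a bounded linear operator on the space of trace class operators with the trace norm;
  only the values of \<open>S\<close> on that space matter.
\<close>

definition bounded_linear_L1 :: "('a::complex_hilbert_space bop \<Rightarrow> 'a bop) \<Rightarrow> bool"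
  where "bounded_linear_L1 S \<longleftrightarrow>
    (\<forall>a\<in>trace_class. S a \<in> trace_class) \<and>
    (\<forall>a\<in>trace_class. \<forall>b\<in>trace_class. S (a + b) = S a + S b) \<and>
    (\<forall>c. \<forall>a\<in>trace_class. S (c *\<^sub>C a) = c *\<^sub>C S a) \<and>
    (\<exists>K. \<forall>a\<in>trace_class. trace_norm (S a) \<le> K * trace_norm a)"

definition pre_adjoint ::
    "('a::complex_hilbert_space bop \<Rightarrow> 'a bop) \<Rightarrow> ('a bop \<Rightarrow> 'a bop) \<Rightarrow> bool"
  where "pre_adjoint S T \<longleftrightarrow>
    bounded_linear_L1 S \<and> (\<forall>a\<in>trace_class. \<forall>x. tr (S a * x) = tr (a * T x))"


section \<open>Operators on the algebra of bounded operators\<close>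

definition positive_map :: "('a::complex_hilbert_space bop \<Rightarrow> 'a bop) \<Rightarrow> bool"
  where "positive_map T \<longleftrightarrow> (\<forall>x. 0 \<le> x \<longrightarrow> 0 \<le> T x)"

definition int_iterate :: "('b \<Rightarrow> 'b) \<Rightarrow> int \<Rightarrow> 'b \<Rightarrow> 'b"
  where "int_iterate T n = (if 0 \<le> n then T ^^ nat n else inv T ^^ nat (- n))"

text \<open>
  Boundedness of all iterates is required explicitly because \<open>onorm\<close> is the operator norm only
  for bounded linear maps.
\<close>

definition doubly_power_bounded :: "('b::real_normed_vector \<Rightarrow> 'b) \<Rightarrow> bool"
  where "doubly_power_bounded T \<longleftrightarrow>
    bij T \<and> (\<forall>n. bounded_linear (int_iterate T n)) \<and>
    bdd_above (range (\<lambda>n. onorm (int_iterate T n)))"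

end

theory Submission
  imports Defs
begin

text \<open>
  Positive unital maps are contractive (Russo-Dye) and unital contractions are positive, so (a)
  and (b) are equivalent, and (b) implies (c) trivially. For (c) implies (a), \<open>S b \<le> b\<close> makes
  \<open>u \<mapsto> tr (b u)\<close> a faithful weight that \<open>T\<close> does not increase, so \<open>T\<close> contracts the seminorm
  \<open>y \<mapsto> inf {tr (b u). - u \<le> y \<le> u}\<close> on self-adjoint operators. Since \<open>b\<close> is trace class,
  norm-bounded sets are precompact for it. If the negative powers of \<open>T\<close> are bounded, then
  for \<open>x \<ge> 0\<close> two of the operators \<open>(inv T ^^ n) x\<close>, with indices \<open>i < j\<close>, are close;
  applying \<open>T ^^ (j - 1)\<close> shows that \<open>inv T x\<close> is close to \<open>(T ^^ (j - i - 1)) x \<ge> 0\<close>.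
\<close>


section \<open>Hilbert spaces and adjoints\<close>

text \<open>The seminorm is built from order intervals because \<open>T\<close> is only positive:
  the modulus of \<open>T y\<close> need not be below \<open>T\<close> of the modulus of
  \<open>y\<close>, whereas \<open>- u \<le> y \<le> u\<close> passes at once to \<open>T y\<close>
  and \<open>T u\<close>. Closeness has to survive many applications of \<open>T\<close>, so it must
  be measured by a quantity that \<open>T\<close> does not increase; for the operator norm the
  recurrence is lost, since bounded sequences in infinite dimension need not have close terms.
  Precompactness comes from splitting off finitely many matrix entries and absorbing the rest in a
  multiple of a projection on which \<open>b\<close> has small trace. Injectivity of
  \<open>b\<close> leads back from the seminorm to the order: the square root \<open>r\<close> of
  \<open>b\<close> has dense range, and the weight of \<open>u\<close> controls the form of
  \<open>u\<close> on that range. The weight is written as the trace of \<open>r * u * r\<close>, a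
  sum of nonnegative terms for \<open>u \<ge> 0\<close>, while the pre-adjoint speaks of
  \<open>b * u\<close>; the Hilbert-Schmidt calculus links the two.\<close>

lemma cinner_scaleC_right:
  "cinner x (c *\<^sub>C y) = cnj c * cinner x (y::'a::complex_hilbert_space)"
  by (metis cinner_commute cinner_scaleC_left complex_cnj_mult)

lemma cinner_minus_left: "cinner (- x) y = - cinner x (y::'a::complex_hilbert_space)"
  using cinner_add_left[of x "- x" y] by (simp add: eq_neg_iff_add_eq_0 add.commute)

lemma cinner_minus_right: "cinner x (- y) = - cinner x (y::'a::complex_hilbert_space)"
  using cinner_add_right[of x y "- y"] by (simp add: eq_neg_iff_add_eq_0 add.commute)

lemma cinner_diff_left: "cinner (x - y) z = cinner x z - cinner y (z::'a::complex_hilbert_space)"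
  using cinner_add_left[of x "- y" z] by (simp add: cinner_minus_left)

lemma cinner_diff_right: "cinner x (y - z) = cinner x y - cinner x (z::'a::complex_hilbert_space)"
  using cinner_add_right[of x y "- z"] by (simp add: cinner_minus_right)

lemma cinner_sum_left:
  "cinner (sum f A) (y::'a::complex_hilbert_space) = (\<Sum>i\<in>A. cinner (f i) y)"
  by (induction A rule: infinite_finite_induct) (auto simp: cinner_add_left)

lemma cinner_sum_right:
  "cinner (y::'a::complex_hilbert_space) (sum f A) = (\<Sum>i\<in>A. cinner y (f i))"
  by (induction A rule: infinite_finite_induct) (auto simp: cinner_add_right)

lemma cinner_self: "cinner x (x::'a::complex_hilbert_space) = of_real ((norm x)\<^sup>2)"
proof -
  have "Im (cinner x x) = 0"
    using cinner_commute[of x x] by (metis complex_cnj_cancel_iff complex_is_Real_iff Reals_cnj_iff)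
  then show ?thesis
    by (simp add: complex_eq_iff Re_cinner power2_norm_eq_inner del: of_real_power)
qed

lemma norm_scaleC: "norm (c *\<^sub>C (x::'a::complex_hilbert_space)) = cmod c * norm x"
proof -
  have "complex_of_real ((norm (c *\<^sub>C x))\<^sup>2) = (c * cnj c) * of_real ((norm x)\<^sup>2)"
    by (simp only: cinner_self[symmetric] cinner_scaleC_left cinner_scaleC_right mult_ac)
  then have "complex_of_real ((norm (c *\<^sub>C x))\<^sup>2) = of_real ((cmod c * norm x)\<^sup>2)"
    by (simp add: complex_norm_square[symmetric] power_mult_distrib)
  then show ?thesis
    by (simp only: of_real_eq_iff power2_eq_iff_nonneg norm_ge_zero mult_nonneg_nonneg)
qed

lemma exists_phase: "\<exists>c. cmod c = 1 \<and> c * z = of_real (cmod z)"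
proof (cases "z = 0")
  case False
  have "cmod (cnj z / of_real (cmod z)) = 1"
    using False by (simp add: norm_divide)
  moreover have "cnj z / of_real (cmod z) * z = of_real (cmod z)"
    using False complex_norm_square[of z] by (simp add: field_simps power2_eq_square)
  ultimately show ?thesis by blast
qed (auto intro: exI[of _ 1])

text \<open>A phase \<open>c\<close> turns \<open>c * cinner x y\<close> into its modulus, so the
  real Cauchy-Schwarz inequality for \<open>c *\<^sub>C x\<close> and \<open>y\<close> gives the
  complex one.\<close>

lemma norm_cinner_le: "cmod (cinner x y) \<le> norm x * norm (y::'a::complex_hilbert_space)"
proof -
  obtain c where c: "cmod c = 1" "c * cinner x y = of_real (cmod (cinner x y))"
    using exists_phase by blast
  have "cmod (cinner x y) = (c *\<^sub>C x) \<bullet> y"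
    using arg_cong[OF c(2), of Re] by (simp only: Re_complex_of_real cinner_scaleC_left[symmetric] Re_cinner)
  also have "\<dots> \<le> norm (c *\<^sub>C x) * norm y"
    by (rule norm_cauchy_schwarz)
  finally show ?thesis by (simp add: norm_scaleC c)
qed

lemma cinner_eq_iff: "(\<forall>z. cinner z x = cinner z (y::'a::complex_hilbert_space)) \<longleftrightarrow> x = y"
proof
  assume "\<forall>z. cinner z x = cinner z y"
  then have "cinner (x - y) (x - y) = 0" by (simp add: cinner_diff_right)
  then show "x = y" by (simp add: cinner_self)
qed simp

lemma scaleC_one [simp]: "1 *\<^sub>C (x::'a::complex_vector) = x"
  using scaleR_scaleC[of 1 x] by simp

lemma scaleC_diff_left: "(c - d) *\<^sub>C x = c *\<^sub>C x - d *\<^sub>C (x::'a::complex_vector)"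
  using scaleC_add_left[of "c - d" d x] by (simp add: eq_diff_eq)

lemma scaleC_zero_left [simp]: "0 *\<^sub>C (x::'a::complex_vector) = 0"
  using scaleC_diff_left[of 0 0 x] by simp

lemma scaleC_minus_left: "(- c) *\<^sub>C x = - (c *\<^sub>C (x::'a::complex_vector))"
  using scaleC_diff_left[of 0 c x] by simp

lemma Im_cinner: "Im (cinner x y) = - ((\<i> *\<^sub>C x) \<bullet> (y::'a::complex_hilbert_space))"
  by (simp add: Re_cinner[symmetric] cinner_scaleC_left)

lemma app_add [simp]: "app a (x + y) = app a x + app a y"
  and app_scaleC [simp]: "app a (c *\<^sub>C x) = c *\<^sub>C app a x"
  and bounded_linear_app: "bounded_linear (app a)"
  using app[of a] by (auto simp: clinear_iff)

lemma linear_app: "linear (app a)"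
  by (rule bounded_linear.linear[OF bounded_linear_app])

lemma app_zero [simp]: "app a 0 = 0"
  and app_diff [simp]: "app a (x - y) = app a x - app a y"
  and app_minus [simp]: "app a (- x) = - app a x"
  and app_scaleR [simp]: "app a (r *\<^sub>R x) = r *\<^sub>R app a x"
  and app_sum: "app a (sum f A) = (\<Sum>i\<in>A. app a (f i))"
  using linear_app[of a]
  by (auto simp: linear_0 linear_diff linear_neg linear_cmul linear_sum)

lemma app_ops [simp]:
  "app (a + b) x = app a x + app b x" "app (a - b) x = app a x - app b x"
  "app (- a) x = - app a x" "app (a * b) x = app a (app b x)" "app 0 x = 0" "app 1 x = x"
  "app (c *\<^sub>C a) x = c *\<^sub>C app a x"
  by (transfer, simp)+

lemma app_scaleR_bop [simp]: "app (r *\<^sub>R a) x = r *\<^sub>R app a x"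
  by (simp add: scaleR_bop_def scaleR_scaleC)

lemma app_sum_bop: "app (sum f A) x = (\<Sum>i\<in>A. app (f i) x)"
  by (induction A rule: infinite_finite_induct) auto

lemma bop_eqI: "(\<And>x. app a x = app b x) \<Longrightarrow> a = b"
  by (simp add: app_inject[symmetric] fun_eq_iff)

lemma norm_app_le: "norm (app a x) \<le> norm a * norm x"
  using onorm[OF bounded_linear_app, of a x] by (simp add: norm_bop.rep_eq)

lemma norm_bop_le: "norm a \<le> C" if "0 \<le> C" "\<And>x. norm (app a x) \<le> C * norm x"
  using that by (simp add: norm_bop.rep_eq onorm_bound)

lemma tendsto_app: "(f \<longlongrightarrow> x) F \<Longrightarrow> ((\<lambda>n. app a (f n)) \<longlongrightarrow> app a x) F"
  by (rule bounded_linear.tendsto[OF bounded_linear_app])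

text \<open>The unital class \<open>real_normed_algebra_1\<close> would require
  \<open>0 \<noteq> 1\<close>, which fails over the zero space.\<close>

instance bop :: (complex_hilbert_space) real_normed_algebra
proof
  fix a b :: "'a bop" and r :: real
  show "r *\<^sub>R a * b = r *\<^sub>R (a * b)" "a * r *\<^sub>R b = r *\<^sub>R (a * b)"
    by (rule bop_eqI, simp)+
  show "norm (a * b) \<le> norm a * norm b"
  proof (rule norm_bop_le)
    fix x
    have "norm (app a (app b x)) \<le> norm a * norm (app b x)" by (rule norm_app_le)
    also have "\<dots> \<le> norm a * (norm b * norm x)"
      by (intro mult_left_mono norm_app_le) simp
    finally show "norm (app (a * b) x) \<le> norm a * norm b * norm x" by (simp add: mult.assoc)
  qed simp
qed

text \<open>Pointwise limits exist since the underlying space is complete, and the Cauchy estimate,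
  uniform on bounded sets of vectors, survives the limit. The iteration for square roots takes its
  limit here.\<close>

instance bop :: (complex_hilbert_space) banach
proof
  fix X :: "nat \<Rightarrow> 'a bop"
  assume X: "Cauchy X"
  have ptw: "Cauchy (\<lambda>n. app (X n) x)" for x
  proof (rule CauchyI)
    fix e :: real
    assume e: "0 < e"
    then obtain M where M: "\<And>m n. m \<ge> M \<Longrightarrow> n \<ge> M \<Longrightarrow> norm (X m - X n) < e / (norm x + 1)"
      using CauchyD[OF X, of "e / (norm x + 1)"] by (auto simp: add_nonneg_pos)
    have "norm (app (X m) x - app (X n) x) < e" if "m \<ge> M" "n \<ge> M" for m n
    proof -
      have "norm (app (X m - X n) x) \<le> norm (X m - X n) * norm x" by (rule norm_app_le)
      also have "\<dots> \<le> norm (X m - X n) * (norm x + 1)" by (simp add: mult_left_mono)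
      also have "\<dots> < e" using M[OF that] by (simp add: pos_less_divide_eq add_nonneg_pos)
      finally show ?thesis by simp
    qed
    then show "\<exists>M. \<forall>m\<ge>M. \<forall>n\<ge>M. norm (app (X m) x - app (X n) x) < e" by blast
  qed
  define f where "f x = lim (\<lambda>n. app (X n) x)" for x
  have f: "(\<lambda>n. app (X n) x) \<longlonglongrightarrow> f x" for x
    using Cauchy_convergent[OF ptw] by (simp add: convergent_LIMSEQ_iff f_def)
  obtain K where K: "\<And>n. norm (X n) \<le> K"
    using Cauchy_Bseq[OF X] by (auto simp: Bseq_def)
  have fadd: "f (x + y) = f x + f y" for x y
    using LIMSEQ_unique[OF f[of "x + y"]] tendsto_add[OF f f, of x y] by simp
  have fscale: "f (c *\<^sub>C x) = c *\<^sub>C f x" for c x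
    using LIMSEQ_unique[OF f[of "c *\<^sub>C x"]] bounded_linear.tendsto[OF bounded_linear_scaleC f, of c x]
    by simp
  have fbound: "norm (f x) \<le> norm x * K" for x
  proof (rule LIMSEQ_le_const2[OF tendsto_norm[OF f]])
    have "norm (app (X n) x) \<le> norm x * K" for n
      using norm_app_le[of "X n" x] mult_right_mono[OF K[of n] norm_ge_zero[of x]]
      by (simp add: mult.commute)
    then show "\<exists>N. \<forall>n\<ge>N. norm (app (X n) x) \<le> norm x * K" by blast
  qed
  have "bounded_linear f"
    by (rule bounded_linear_intro[OF fadd _ fbound]) (simp add: scaleR_scaleC fscale)
  then have app_f: "app (Bop f) = f"
    by (intro Bop_inverse) (simp add: clinear_iff fadd fscale)
  have "X \<longlonglongrightarrow> Bop f"
  proof (rule LIMSEQ_I)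
    fix e :: real
    assume e: "0 < e"
    obtain M where M: "\<And>m n. m \<ge> M \<Longrightarrow> n \<ge> M \<Longrightarrow> norm (X m - X n) < e / 2"
      using CauchyD[OF X, of "e / 2"] e by auto
    have "norm (X n - Bop f) < e" if n: "n \<ge> M" for n
    proof -
      have "norm (app (X n) x - f x) \<le> e / 2 * norm x" for x
      proof (rule LIMSEQ_le_const2[OF tendsto_norm[OF tendsto_diff[OF tendsto_const f]]])
        have "norm (app (X n) x - app (X m) x) \<le> e / 2 * norm x" if m: "m \<ge> M" for m
          using norm_app_le[of "X n - X m" x]
            mult_right_mono[OF less_imp_le[OF M[OF n m]] norm_ge_zero[of x]] by simp
        then show "\<exists>N. \<forall>m\<ge>N. norm (app (X n) x - app (X m) x) \<le> e / 2 * norm x" by blast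
      qed
      then have "norm (X n - Bop f) \<le> e / 2"
        using e by (intro norm_bop_le) (simp_all add: app_f)
      then show ?thesis using e by simp
    qed
    then show "\<exists>N. \<forall>n\<ge>N. norm (X n - Bop f) < e" by blast
  qed
  then show "convergent X" by (auto simp: convergent_def)
qed

section \<open>Orthogonality, the Riesz representation and adjoints\<close>

definition csubspace :: "'a::complex_vector set \<Rightarrow> bool"
  where "csubspace M \<longleftrightarrow> 0 \<in> M \<and> (\<forall>x\<in>M. \<forall>y\<in>M. x + y \<in> M) \<and> (\<forall>c. \<forall>x\<in>M. c *\<^sub>C x \<in> M)"

lemma csubspace_scaleR: "csubspace M \<Longrightarrow> x \<in> M \<Longrightarrow> r *\<^sub>R x \<in> M"
  by (simp add: csubspace_def scaleR_scaleC)

text \<open>A vector of least norm in the closure of \<open>x - M\<close> is orthogonal to \<open>M\<close>, hence zero.\<close>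

lemma csubspace_dense:
  fixes M :: "'a::complex_hilbert_space set"
  assumes M: "csubspace M" and orth: "\<And>y. (\<And>m. m \<in> M \<Longrightarrow> cinner m y = 0) \<Longrightarrow> y = 0"
    and e: "0 < e"
  shows "\<exists>m\<in>M. norm (x - m) < e"
proof -
  define d where "d = (INF m\<in>M. (norm (x - m))\<^sup>2)"
  have ne: "M \<noteq> {}" using M by (auto simp: csubspace_def)
  have bdd: "bdd_below ((\<lambda>m. (norm (x - m))\<^sup>2) ` M)" by (rule bdd_belowI[of _ 0]) auto
  have d_le: "d \<le> (norm (x - m))\<^sup>2" if "m \<in> M" for m
    unfolding d_def using bdd that by (rule cINF_lower)
  have "\<exists>m\<in>M. (norm (x - m))\<^sup>2 < d + 1 / Suc n" for n
    using cINF_less_iff[OF ne bdd, of "d + 1 / Suc n"] by (simp add: d_def)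
  then obtain m where m: "m n \<in> M" "(norm (x - m n))\<^sup>2 < d + 1 / Suc n" for n by metis
  \<comment> \<open>The midpoint of \<open>m i\<close> and \<open>m j\<close> lies in
    \<open>M\<close>, so its squared distance to \<open>x\<close> is at least \<open>d\<close>; the
    parallelogram law then forces two near-minimisers to be close.\<close>
  have m_mid: "(norm (m i - m j))\<^sup>2 \<le> 2 / Suc i + 2 / Suc j" for i j
  proof -
    have "(1/2) *\<^sub>R (m i + m j) \<in> M"
      using M m(1) by (intro csubspace_scaleR) (auto simp: csubspace_def)
    from d_le[OF this] have "4 * d \<le> 4 * (norm (x - (1/2) *\<^sub>R (m i + m j)))\<^sup>2" by simp
    also have "\<dots> = (norm (2 *\<^sub>R (x - (1/2) *\<^sub>R (m i + m j))))\<^sup>2"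
      by (simp add: power_mult_distrib)
    also have "2 *\<^sub>R (x - (1/2) *\<^sub>R (m i + m j)) = (x - m i) + (x - m j)"
      by (simp add: scaleR_2 algebra_simps)
    finally have "4 * d \<le> (norm ((x - m i) + (x - m j)))\<^sup>2" .
    moreover have "(norm ((x - m i) + (x - m j)))\<^sup>2 + (norm ((x - m j) - (x - m i)))\<^sup>2
        = 2 * (norm (x - m i))\<^sup>2 + 2 * (norm (x - m j))\<^sup>2"
      by (simp add: power2_norm_eq_inner inner_add_left inner_add_right inner_diff_left
          inner_diff_right inner_commute)
    ultimately show ?thesis using m(2)[of i] m(2)[of j] by simp
  qed
  have "Cauchy m"
  proof (rule CauchyI)
    fix c :: real
    assume c: "0 < c"
    then obtain K where K: "4 / c\<^sup>2 < of_nat (Suc K)"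
      using reals_Archimedean2[of "4 / c\<^sup>2"] by (metis less_trans of_nat_less_iff lessI)
    then have K': "4 / Suc K < c\<^sup>2" using c by (simp add: field_simps)
    have "norm (m i - m j) < c" if ij: "i \<ge> K" "j \<ge> K" for i j
    proof -
      have "2 / Suc i \<le> 2 / Suc K" "2 / Suc j \<le> 2 / Suc K"
        using ij by (simp_all add: frac_le)
      then have "(norm (m i - m j))\<^sup>2 < c\<^sup>2" using m_mid[of i j] K' by simp
      then show ?thesis using c by (simp add: power2_less_imp_less)
    qed
    then show "\<exists>K. \<forall>i\<ge>K. \<forall>j\<ge>K. norm (m i - m j) < c" by blast
  qed
  then obtain l where l: "m \<longlonglongrightarrow> l"
    using Cauchy_convergent unfolding convergent_def by blast
  define y where "y = x - l"
  have lim: "(\<lambda>n. (norm (x - m n))\<^sup>2) \<longlonglongrightarrow> (norm y)\<^sup>2"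
    unfolding y_def by (intro tendsto_intros l)
  have "(norm y)\<^sup>2 \<le> d"
  proof (rule LIMSEQ_le[OF lim])
    show "(\<lambda>n. d + 1 / Suc n) \<longlonglongrightarrow> d"
      using tendsto_add[OF tendsto_const LIMSEQ_Suc[OF lim_1_over_n], of d] by simp
    show "\<exists>N. \<forall>n\<ge>N. (norm (x - m n))\<^sup>2 \<le> d + 1 / Suc n" using m(2) less_imp_le by blast
  qed
  have min: "(norm y)\<^sup>2 \<le> (norm (y - k))\<^sup>2" if k: "k \<in> M" for k
  proof -
    have "d \<le> (norm (y - k))\<^sup>2"
    proof (rule LIMSEQ_le_const)
      show "(\<lambda>n. (norm (x - m n - k))\<^sup>2) \<longlonglongrightarrow> (norm (y - k))\<^sup>2"
        unfolding y_def by (intro tendsto_intros l)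
      have "d \<le> (norm (x - m n - k))\<^sup>2" for n
        using d_le[of "m n + k"] M m(1)[of n] k by (simp add: csubspace_def diff_diff_eq)
      then show "\<exists>N. \<forall>n\<ge>N. d \<le> (norm (x - m n - k))\<^sup>2" by blast
    qed
    then show ?thesis using \<open>(norm y)\<^sup>2 \<le> d\<close> by linarith
  qed
  have real_orth: "k \<bullet> y = 0" if k: "k \<in> M" for k
  proof (cases "k = 0")
    case False
    \<comment> \<open>The minimiser of \<open>norm (y - t *\<^sub>R k)\<close> over all real
      \<open>t\<close>.\<close>
    define t where "t = (k \<bullet> y) / (k \<bullet> k)"
    have kk: "k \<bullet> k > 0" using False by simp
    have "(norm y)\<^sup>2 \<le> (norm (y - t *\<^sub>R k))\<^sup>2" by (rule min[OF csubspace_scaleR[OF M k]])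
    also have "\<dots> = (norm y)\<^sup>2 - 2 * t * (k \<bullet> y) + t * t * (k \<bullet> k)"
      by (simp add: power2_norm_eq_inner inner_diff_left inner_diff_right inner_commute algebra_simps)
    also have "\<dots> = (norm y)\<^sup>2 - (k \<bullet> y)\<^sup>2 / (k \<bullet> k)"
      using kk by (simp add: t_def field_simps power2_eq_square)
    finally show ?thesis using kk by (simp add: divide_le_0_iff)
  qed simp
  have "y = 0"
  proof (rule orth)
    fix k assume k: "k \<in> M"
    then have "\<i> *\<^sub>C k \<in> M" using M by (simp add: csubspace_def)
    with k show "cinner k y = 0"
      by (simp add: complex_eq_iff Re_cinner Im_cinner real_orth)
  qed
  then have "x = l" by (simp add: y_def)
  with l e obtain n where "norm (m n - x) < e" by (metis LIMSEQ_D order_refl)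
  then show ?thesis using m(1) by (auto simp: norm_minus_commute)
qed

text \<open>If only zero is orthogonal to the kernel of \<open>f\<close>, the kernel is dense and
  continuity gives \<open>f = 0\<close>. Otherwise some nonzero \<open>y\<close> is orthogonal to
  the kernel, and since \<open>x - (f x / f y) *\<^sub>C y\<close> lies in the kernel,
  \<open>f x\<close> is determined by \<open>cinner x y\<close>.\<close>

lemma riesz_representation:
  fixes f :: "'a::complex_hilbert_space \<Rightarrow> complex"
  assumes add: "\<And>x y. f (x + y) = f x + f y" and scale: "\<And>c x. f (c *\<^sub>C x) = c * f x"
    and bound: "\<And>x. cmod (f x) \<le> K * norm x"
  shows "\<exists>w. \<forall>x. f x = cinner x w"
proof (cases "\<forall>y. (\<forall>m. f m = 0 \<longrightarrow> cinner m y = 0) \<longrightarrow> y = 0")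
  case True
  have f0: "f 0 = 0" using scale[of 0 0] by simp
  have fdiff: "f (x - y) = f x - f y" for x y using add[of "x - y" y] by simp
  have sub: "csubspace {m. f m = 0}" by (simp add: csubspace_def f0 add scale)
  have "f x = 0" for x
  proof (rule ccontr)
    assume nz: "f x \<noteq> 0"
    have K: "0 < \<bar>K\<bar> + 1" by simp
    obtain m where m: "f m = 0" "norm (x - m) < cmod (f x) / (\<bar>K\<bar> + 1)"
      using csubspace_dense[OF sub, of "cmod (f x) / (\<bar>K\<bar> + 1)" x] True nz K by auto
    have "cmod (f x) \<le> K * norm (x - m)" using bound[of "x - m"] m by (simp add: fdiff)
    also have "\<dots> \<le> (\<bar>K\<bar> + 1) * norm (x - m)" by (rule mult_right_mono) auto
    also have "\<dots> < cmod (f x)" using m(2) K by (simp add: pos_less_divide_eq mult.commute)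
    finally show False by simp
  qed
  then show ?thesis by (intro exI[of _ 0]) simp
next
  case False
  then obtain y where y: "\<And>m. f m = 0 \<Longrightarrow> cinner m y = 0" "y \<noteq> 0" by blast
  have fdiff: "f (x - y) = f x - f y" for x y using add[of "x - y" y] by simp
  have fy: "f y \<noteq> 0" using y(1)[of y] y(2) by (auto simp: cinner_self)
  have "f x = cinner x ((cnj (f y) / of_real ((norm y)\<^sup>2)) *\<^sub>C y)" for x
  proof -
    have "f (x - (f x / f y) *\<^sub>C y) = 0" using fy by (simp add: fdiff scale)
    from y(1)[OF this] have "cinner x y = f x / f y * of_real ((norm y)\<^sup>2)"
      by (simp add: cinner_diff_left cinner_scaleC_left cinner_self)
    then show ?thesis using fy y(2) by (simp add: cinner_scaleC_right)
  qed
  then show ?thesis by blast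
qed

text \<open>Riesz representation of \<open>x \<mapsto> cinner (app a x) y\<close> for each
  \<open>y\<close>. As \<open>adj\<close> is a definite description, existence is needed before
  \<open>adj a\<close> is known to satisfy its defining equation.\<close>

lemma ex_adjoint: "\<exists>b. \<forall>x y. cinner (app a x) y = cinner x (app b y)"
proof -
  have "\<exists>w. \<forall>x. cinner (app a x) y = cinner x w" for y
  proof (rule riesz_representation)
    show "cmod (cinner (app a x) y) \<le> (norm a * norm y) * norm x" for x
      using order_trans[OF norm_cinner_le mult_right_mono[OF norm_app_le norm_ge_zero], of a x y]
      by (simp add: mult_ac)
  qed (simp_all add: cinner_add_left cinner_scaleC_left)
  then obtain g where g: "\<And>x y. cinner (app a x) y = cinner x (g y)" by metis
  have gadd: "g (x + y) = g x + g y" for x y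
    by (subst cinner_eq_iff[symmetric]) (simp add: g[symmetric] cinner_add_right)
  have gscale: "g (c *\<^sub>C x) = c *\<^sub>C g x" for c x
    by (subst cinner_eq_iff[symmetric]) (simp add: g[symmetric] cinner_scaleC_right)
  have gbound: "norm (g y) \<le> norm y * norm a" for y
  proof (cases "g y = 0")
    case False
    have "(norm (g y))\<^sup>2 = cmod (cinner (app a (g y)) y)"
      unfolding g cinner_self norm_of_real by simp
    also have "\<dots> \<le> (norm a * norm (g y)) * norm y"
      by (rule order_trans[OF norm_cinner_le mult_right_mono[OF norm_app_le norm_ge_zero]])
    finally show ?thesis using False by (simp add: power2_eq_square mult_ac)
  qed simp
  have "bounded_linear g"
    by (rule bounded_linear_intro[OF gadd _ gbound]) (simp add: scaleR_scaleC gscale)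
  then have "app (Bop g) = g"
    by (intro Bop_inverse) (simp add: clinear_iff gadd gscale)
  then show ?thesis using g by metis
qed

lemma adj_eqI:
  assumes "\<And>x y. cinner (app a x) y = cinner x (app b y)"
  shows "adj a = b"
  unfolding adj_def
proof (rule the_equality)
  fix c
  assume c: "\<forall>x y. cinner (app a x) y = cinner x (app c y)"
  show "c = b"
  proof (rule bop_eqI)
    fix y
    have "\<forall>x. cinner x (app c y) = cinner x (app b y)"
      using c assms by simp
    then show "app c y = app b y" by (simp only: cinner_eq_iff)
  qed
qed (simp add: assms)

lemma cinner_app_left: "cinner (app a x) y = cinner x (app (adj a) y)"
  using ex_adjoint[of a] adj_eqI[of a] by metis

lemma cinner_app_right: "cinner x (app a y) = cinner (app (adj a) x) y"
  by (metis cinner_app_left cinner_commute)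

lemma inner_app_left: "app a x \<bullet> y = x \<bullet> app (adj a) y"
  by (simp add: Re_cinner[symmetric] cinner_app_left)

lemma adj_adj [simp]: "adj (adj a) = a"
  by (rule adj_eqI) (simp add: cinner_app_right)

lemma inner_app_adj: "app (adj a) x \<bullet> x = app a x \<bullet> x"
  by (metis inner_app_left inner_commute)

lemma adj_add: "adj (a + b) = adj a + adj b"
  and adj_diff: "adj (a - b) = adj a - adj b"
  and adj_mult: "adj (a * b) = adj b * adj a"
  and adj_scaleC: "adj (c *\<^sub>C a) = cnj c *\<^sub>C adj a"
  and adj_one [simp]: "adj 1 = 1"
  and adj_zero [simp]: "adj 0 = 0"
  by (rule adj_eqI; simp add: cinner_app_left cinner_add_left cinner_add_right cinner_diff_left
      cinner_diff_right cinner_scaleC_left cinner_scaleC_right)+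

lemma adj_minus: "adj (- a) = - adj a"
  using adj_diff[of 0 a] by simp

lemma adj_scaleR: "adj (r *\<^sub>R a) = r *\<^sub>R adj a"
  by (simp add: scaleR_bop_def adj_scaleC)

lemma adj_sum: "adj (sum f A) = (\<Sum>i\<in>A. adj (f i))"
  by (induction A rule: infinite_finite_induct) (auto simp: adj_add)

lemma adj_power: "adj (a ^ n) = adj a ^ n"
  by (induction n) (simp_all add: adj_mult power_commutes)

lemma adj_eq_iff: "adj a = a \<longleftrightarrow> (\<forall>x y. cinner (app a x) y = cinner x (app a y))"
  by (metis adj_eqI cinner_app_left)

lemma nonneg_bop_iff: "0 \<le> a \<longleftrightarrow> adj a = a \<and> (\<forall>x. 0 \<le> app a x \<bullet> x)"
  unfolding adj_eq_iff by transfer (simp add: Re_cinner)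

lemma less_eq_bop_iff: "a \<le> b \<longleftrightarrow> adj (b - a) = b - a \<and> (\<forall>x. app a x \<bullet> x \<le> app b x \<bullet> x)"
  using nonneg_bop_iff[of "b - a"] by (simp add: inner_diff_left)

lemma adj_nonneg: "0 \<le> a \<Longrightarrow> adj a = a"
  by (simp add: nonneg_bop_iff)

lemma norm_adj_le: "norm (adj a) \<le> norm a"
proof (rule norm_bop_le)
  fix y
  show "norm (app (adj a) y) \<le> norm a * norm y"
  proof (cases "app (adj a) y = 0")
    case False
    have "(norm (app (adj a) y))\<^sup>2 = app a (app (adj a) y) \<bullet> y"
      by (simp only: inner_app_left power2_norm_eq_inner)
    also have "\<dots> \<le> norm a * norm (app (adj a) y) * norm y"
      by (rule order_trans[OF norm_cauchy_schwarz mult_right_mono[OF norm_app_le norm_ge_zero]])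
    finally show ?thesis using False by (simp add: power2_eq_square mult_ac)
  qed simp
qed simp

lemma continuous_adj: "X \<longlonglongrightarrow> a \<Longrightarrow> (\<lambda>n. adj (X n)) \<longlonglongrightarrow> adj a"
proof -
  assume X: "X \<longlonglongrightarrow> a"
  have "bounded_linear (adj :: 'a bop \<Rightarrow> 'a bop)"
    by (rule bounded_linear_intro[where K = 1]) (simp_all add: adj_add adj_scaleR norm_adj_le)
  from bounded_linear.tendsto[OF this X] show ?thesis .
qed


section \<open>Positive operators and square roots\<close>

text \<open>Expansion of the nonnegative form at \<open>x - y\<close>. This additive substitute for
  the Cauchy-Schwarz inequality of the form can be summed over several positive operators.\<close>

lemma inner_app_le_average:
  assumes "0 \<le> a"
  shows "app a x \<bullet> y \<le> (app a x \<bullet> x + app a y \<bullet> y) / 2"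
proof -
  have "0 \<le> app a (x - y) \<bullet> (x - y)" using assms by (simp only: nonneg_bop_iff)
  moreover have "app a y \<bullet> x = app a x \<bullet> y"
    by (metis assms adj_nonneg inner_app_left inner_commute)
  ultimately show ?thesis by (simp add: inner_diff_left inner_diff_right)
qed

lemma norm_bop_le_form:
  assumes C: "0 \<le> C" and form: "\<And>x y. app a x \<bullet> y \<le> C * ((norm x)\<^sup>2 + (norm y)\<^sup>2) / 2"
  shows "norm a \<le> C"
proof (rule norm_bop_le[OF C])
  fix x
  show "norm (app a x) \<le> C * norm x"
  proof (cases "x = 0 \<or> app a x = 0")
    case True
    then show ?thesis using C by auto
  next
    case False
    \<comment> \<open>Scaling \<open>app a x\<close> to the length of \<open>x\<close> balances the
      two squares, so that their mean is \<open>(norm x)\<^sup>2\<close>.\<close>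
    define y where "y = (norm x / norm (app a x)) *\<^sub>R app a x"
    have ny: "norm y = norm x" using False by (simp add: y_def)
    have "norm x * norm (app a x) = app a x \<bullet> y"
      using False by (simp add: y_def dot_square_norm power2_eq_square)
    also have "\<dots> \<le> norm x * (C * norm x)"
      using form[of x y] by (simp add: ny power2_eq_square mult_ac)
    finally show ?thesis using False by simp
  qed
qed

lemma norm_nonneg_bop_le:
  assumes a: "0 \<le> a" and C: "0 \<le> C" and form: "\<And>x. app a x \<bullet> x \<le> C * (norm x)\<^sup>2"
  shows "norm a \<le> C"
proof (rule norm_bop_le_form[OF C])
  fix x y
  show "app a x \<bullet> y \<le> C * ((norm x)\<^sup>2 + (norm y)\<^sup>2) / 2"
    using inner_app_le_average[OF a, of x y] form[of x] form[of y] by (simp add: distrib_left)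
qed

lemma inner_app_le_norm: "app a x \<bullet> x \<le> norm a * (norm x)\<^sup>2"
  using order_trans[OF norm_cauchy_schwarz mult_right_mono[OF norm_app_le norm_ge_zero], of a x x]
  by (simp add: power2_eq_square mult_ac)

lemma nonneg_scaleR_bop: "0 \<le> a \<Longrightarrow> 0 \<le> s \<Longrightarrow> 0 \<le> s *\<^sub>R (a :: 'a::complex_hilbert_space bop)"
  by (simp add: nonneg_bop_iff adj_scaleR)

lemma one_bop_nonneg: "0 \<le> (1 :: 'a::complex_hilbert_space bop)"
  by (simp add: nonneg_bop_iff)

lemma le_norm_scaleR_one: "adj a = a \<Longrightarrow> a \<le> norm a *\<^sub>R 1"
  using inner_app_le_norm[of a]
  by (simp add: less_eq_bop_iff adj_diff adj_scaleR power2_norm_eq_inner)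

lemma nonneg_conj: "0 \<le> a \<Longrightarrow> 0 \<le> adj c * a * c"
  by (auto simp: nonneg_bop_iff adj_mult mult.assoc) (metis adj_adj inner_app_left)

text \<open>
  With \<open>s y = s - a\<close> and \<open>0 \<le> y \<le> 1\<close>, the iteration \<open>z \<mapsto> (y + z\<^sup>2) / 2\<close> converges
  in norm, because the same scalar iteration with \<open>y = 1\<close> is a majorant; the limit satisfies
  \<open>(1 - z)\<^sup>2 = 1 - y\<close>.
\<close>

lemma ex_sqrt_bop:
  fixes a :: "'a::complex_hilbert_space bop"
  assumes a: "0 \<le> a"
  shows "\<exists>r. 0 \<le> r \<and> r * r = a \<and> (\<forall>x. x * a = a * x \<longrightarrow> x * r = r * x)"
proof -
  \<comment> \<open>The summand 1 keeps \<open>s\<close> positive when \<open>a = 0\<close>.\<close>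
  define s where "s = norm a + 1"
  have s: "0 < s" by (simp add: s_def add_nonneg_pos)
  define y where "y = 1 - (1 / s) *\<^sub>R a"
  have app_y: "app y x \<bullet> x = (norm x)\<^sup>2 - (app a x \<bullet> x) / s" for x
    by (simp add: y_def inner_diff_left power2_norm_eq_inner)
  have "app a x \<bullet> x \<le> s * (norm x)\<^sup>2" for x
    by (rule order_trans[OF inner_app_le_norm mult_right_mono]) (simp_all add: s_def)
  then have y: "0 \<le> y"
    using s a by (auto simp: nonneg_bop_iff app_y y_def adj_diff adj_scaleR pos_divide_le_eq
        mult.commute power2_norm_eq_inner inner_diff_left)
  have ny: "norm y \<le> 1"
    using y s a by (intro norm_nonneg_bop_le) (auto simp: app_y nonneg_bop_iff)
  define z where "z = rec_nat 0 (\<lambda>_ w. (1/2) *\<^sub>R (y + w * w))"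
  define t where "t = rec_nat (0::real) (\<lambda>_ w. (1 + w * w) / 2)"
  have z0: "z 0 = 0" and zS: "z (Suc n) = (1/2) *\<^sub>R (y + z n * z n)"
    and t0: "t 0 = 0" and tS: "t (Suc n) = (1 + t n * t n) / 2" for n
    by (simp_all add: z_def t_def)
  have t01: "0 \<le> t n \<and> t n \<le> 1" for n
  proof (induction n)
    case (Suc n)
    then have "t n * t n \<le> 1" by (intro mult_le_one) auto
    then show ?case by (simp add: tS)
  qed (simp add: t0)
  \<comment> \<open>The difference of the two sides is \<open>(1 - t n)\<^sup>2 / 2\<close>.\<close>
  have t_step: "t n \<le> t (Suc n)" for n
    using zero_le_power2[of "1 - t n"] unfolding tS by (simp add: power2_eq_square algebra_simps)
  have zt: "norm (z n) \<le> t n" for n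
  proof (induction n)
    case (Suc n)
    have "norm (z n * z n) \<le> t n * t n"
      using Suc t01[of n] by (intro order_trans[OF norm_mult_ineq] mult_mono) auto
    then have "norm (y + z n * z n) \<le> 1 + t n * t n" using ny norm_triangle_ineq[of y "z n * z n"] by simp
    then show ?case by (simp add: zS tS)
  qed (simp add: z0 t0)
  have comm: "x * z n = z n * x" if x: "x * a = a * x" for x n
  proof (induction n)
    case (Suc n)
    have "x * (z n * z n) = (z n * z n) * x" by (metis Suc mult.assoc)
    moreover have "x * y = y * x" using x by (simp add: y_def algebra_simps)
    ultimately show ?case by (simp add: zS algebra_simps)
  qed (simp add: z0)
  have zz: "z m * z n = z n * z m" for m n
    by (rule comm) (metis comm)
  have adjz: "adj (z n) = z n" for n
    using adj_nonneg[OF y] by (induction n) (simp_all add: z0 zS adj_scaleR adj_add adj_mult)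
  \<comment> \<open>The iterates commute, so differences of squares factor as for numbers, and each
    factor is majorised by its scalar counterpart.\<close>
  have z_step: "norm (z (Suc n) - z n) \<le> t (Suc n) - t n" for n
  proof (induction n)
    case 0
    then show ?case using ny by (simp add: z0 zS t0 tS)
  next
    case (Suc n)
    have "z (Suc (Suc n)) - z (Suc n) = (1/2) *\<^sub>R (z (Suc n) * z (Suc n) - z n * z n)"
      by (simp add: zS[of "Suc n"] zS[of n] scaleR_diff_right[symmetric] del: scaleR_diff_right)
    also have "z (Suc n) * z (Suc n) - z n * z n = (z (Suc n) + z n) * (z (Suc n) - z n)"
      using zz[of "Suc n" n] by (simp add: algebra_simps)
    finally have "norm (z (Suc (Suc n)) - z (Suc n)) \<le> (norm (z (Suc n) + z n) * norm (z (Suc n) - z n)) / 2"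
      using norm_mult_ineq[of "z (Suc n) + z n" "z (Suc n) - z n"] by simp
    also have "\<dots> \<le> ((t (Suc n) + t n) * (t (Suc n) - t n)) / 2"
      using Suc zt[of n] zt[of "Suc n"] norm_triangle_ineq[of "z (Suc n)" "z n"]
        t01[of n] t01[of "Suc n"]
      by (intro divide_right_mono mult_mono) auto
    also have "\<dots> = (1 + t (Suc n) * t (Suc n)) / 2 - (1 + t n * t n) / 2"
      by (simp add: field_simps)
    also have "\<dots> = t (Suc (Suc n)) - t (Suc n)"
      by (simp only: tS[of "Suc n"] tS[of n])
    finally show ?case .
  qed
  have tele: "norm (z (n + k) - z n) \<le> t (n + k) - t n" for n k
  proof (induction k)
    case (Suc k)
    have "norm (z (n + Suc k) - z n) \<le> norm (z (Suc (n + k)) - z (n + k)) + norm (z (n + k) - z n)"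
      using norm_triangle_ineq[of "z (Suc (n + k)) - z (n + k)" "z (n + k) - z n"] by simp
    also have "\<dots> \<le> (t (Suc (n + k)) - t (n + k)) + (t (n + k) - t n)"
      by (intro add_mono z_step Suc)
    finally show ?case by simp
  qed simp
  have "incseq t" by (rule incseq_SucI) (rule t_step)
  then have "convergent t"
    using t01 by (intro Bseq_mono_convergent BseqI'[of _ 1]) (auto simp: incseq_def)
  then have "Cauchy t" by (rule convergent_Cauchy)
  have "Cauchy z"
  proof (rule metric_CauchyI)
    fix e :: real assume "0 < e"
    then obtain N where N: "\<And>m n. m \<ge> N \<Longrightarrow> n \<ge> N \<Longrightarrow> dist (t m) (t n) < e"
      using metric_CauchyD[OF \<open>Cauchy t\<close>] by blast
    have *: "dist (z m) (z n) < e" if "n \<ge> N" "m \<ge> n" for m n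
    proof -
      have "norm (z m - z n) \<le> t m - t n" using tele[of n "m - n"] that by simp
      also have "\<dots> < e" using N[of m n] that by (auto simp: dist_real_def)
      finally show ?thesis by (simp add: dist_norm)
    qed
    then have "dist (z m) (z n) < e" if "n \<ge> N" "m \<ge> N" for m n
      using that by (metis dist_commute nat_le_linear)
    then show "\<exists>M. \<forall>m\<ge>M. \<forall>n\<ge>M. dist (z m) (z n) < e" by blast
  qed
  then obtain w where w: "z \<longlonglongrightarrow> w"
    using Cauchy_convergent unfolding convergent_def by blast
  have "(\<lambda>n. z (Suc n)) \<longlonglongrightarrow> (1/2) *\<^sub>R (y + w * w)"
    unfolding zS by (intro tendsto_intros w)
  then have w_eq: "w = (1/2) *\<^sub>R (y + w * w)"
    using LIMSEQ_unique[OF LIMSEQ_Suc[OF w]] by blast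
  then have w2: "2 *\<^sub>R w = y + w * w"
    by (metis scaleR_scaleR scaleR_one nonzero_mult_div_cancel_left times_divide_eq_right mult.right_neutral
        zero_neq_numeral)
  have adjw: "adj w = w"
    using LIMSEQ_unique[OF continuous_adj[OF w]] w by (simp add: adjz)
  have nw: "norm w \<le> 1"
    using zt t01 by (intro LIMSEQ_le_const2[OF tendsto_norm[OF w]]) (meson order_trans)
  define r where "r = sqrt s *\<^sub>R (1 - w)"
  have w_le: "app w x \<bullet> x \<le> (norm x)\<^sup>2" for x
    using order_trans[OF inner_app_le_norm mult_right_mono[OF nw]] by fastforce
  have "0 \<le> r"
    unfolding r_def using s w_le
    by (intro nonneg_scaleR_bop) (auto simp: nonneg_bop_iff adj_diff adjw inner_diff_left
        power2_norm_eq_inner)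
  moreover have "r * r = a"
  proof -
    have "r * r = s *\<^sub>R ((1 - w) * (1 - w))" using s by (simp add: r_def)
    also have "(1 - w) * (1 - w) = 1 - 2 *\<^sub>R w + w * w" by (simp add: algebra_simps scaleR_2)
    also have "\<dots> = 1 - y" unfolding w2 by simp
    finally show ?thesis using s by (simp add: y_def)
  qed
  \<comment> \<open>The iterates are polynomials in \<open>a\<close>, and commutation passes to
    their limit. The uniqueness of square roots rests on this clause.\<close>
  moreover have "x * r = r * x" if x: "x * a = a * x" for x
  proof -
    have "(\<lambda>n. x * z n) \<longlonglongrightarrow> w * x"
      unfolding comm[OF x] by (intro tendsto_intros w)
    moreover have "(\<lambda>n. x * z n) \<longlonglongrightarrow> x * w" by (intro tendsto_intros w)
    ultimately have "w * x = x * w" by (rule LIMSEQ_unique)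
    then show ?thesis by (simp add: r_def algebra_simps)
  qed
  ultimately show ?thesis by blast
qed

lemma square_hermitian_eq_0: "adj d = d \<Longrightarrow> d * d = 0 \<Longrightarrow> d = 0"
proof (rule bop_eqI)
  fix x
  assume d: "adj d = d" "d * d = 0"
  have "app d x \<bullet> app d x = x \<bullet> app (d * d) x"
    by (simp only: inner_app_left d(1) app_ops)
  then show "app d x = app 0 x"
    by (simp only: d(2) app_ops inner_zero_right inner_eq_zero_iff)
qed

text \<open>For commuting positive \<open>q\<close> and \<open>b\<close> with equal squares,
  \<open>d = q - b\<close> satisfies \<open>d * q * d + d * b * d = 0\<close>; both summands are
  positive, hence zero, so \<open>d * d * d = 0\<close> and \<open>d = 0\<close>. Two arbitrary
  roots are not known to commute, so each is compared with the root that commutes with everything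
  commuting with the square.\<close>

lemma sqrt_bop_unique:
  fixes r s :: "'a::complex_hilbert_space bop"
  assumes "0 \<le> r" "0 \<le> s" "r * r = s * s"
  shows "r = s"
proof -
  have eq: "q = b" if q: "0 \<le> q" "q * q = b * b" "\<And>x. x * (b * b) = (b * b) * x \<Longrightarrow> x * q = q * x"
    and b: "0 \<le> b" for q b :: "'a bop"
  proof -
    define d where "d = q - b"
    have adjd: "adj d = d" using q(1) b by (simp add: d_def adj_diff adj_nonneg)
    have bq: "b * q = q * b" by (rule q(3)) (simp add: mult.assoc)
    have "d * q * d + d * b * d = d * ((q + b) * (q - b))" by (simp add: d_def algebra_simps)
    also have "(q + b) * (q - b) = 0" using bq q(2) by (simp add: algebra_simps)
    finally have sum: "d * q * d + d * b * d = 0" by simp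
    have nn: "0 \<le> d * q * d" "0 \<le> d * b * d"
      using nonneg_conj[OF q(1), of d] nonneg_conj[OF b, of d] by (simp_all add: adjd)
    then have "d * q * d = 0" "d * b * d = 0"
      using sum by (metis add_nonneg_eq_0_iff)+
    moreover have "d * d * d = d * q * d - d * b * d" by (simp add: d_def algebra_simps)
    ultimately have "d * d * d = 0" by simp
    then have "(d * d) * (d * d) = 0" by (simp add: mult.assoc[symmetric])
    then have "d * d = 0" by (intro square_hermitian_eq_0[of "d * d"]) (simp add: adj_mult adjd)
    then have "d = 0" by (rule square_hermitian_eq_0[OF adjd])
    then show ?thesis by (simp add: d_def)
  qed
  have "0 \<le> s * s" using nonneg_conj[OF one_bop_nonneg, of s] assms(2) by (simp add: adj_nonneg)
  then obtain q where q: "0 \<le> q" "q * q = s * s" "\<And>x. x * (s * s) = (s * s) * x \<Longrightarrow> x * q = q * x"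
    using ex_sqrt_bop by blast
  have "q = r"
    by (rule eq[OF q(1) _ _ assms(1)]) (simp_all only: q(2,3) assms(3))
  moreover have "q = s"
    by (rule eq[OF q(1,2) _ assms(2)]) (simp only: q(3))
  ultimately show ?thesis by simp
qed

text \<open>This turns the trace class condition on a positive operator into a condition on its own
  diagonal.\<close>

lemma abs_bop_nonneg: "0 \<le> a \<Longrightarrow> abs_bop a = a"
  unfolding abs_bop_def by (rule the_equality) (auto simp: adj_nonneg intro: sqrt_bop_unique)


section \<open>Orthonormal bases and Hilbert-Schmidt operators\<close>

lemma has_sum_diff:
  fixes f g :: "'i \<Rightarrow> real"
  assumes "(f has_sum a) A" "(g has_sum b) A"
  shows "((\<lambda>x. f x - g x) has_sum (a - b)) A"
  using has_sum_add[OF assms(1), of "\<lambda>x. - g x" "- b"] assms(2) by (simp add: has_sum_uminus)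

lemma orthonormal_cinner_sum:
  assumes "orthonormal E" "finite F" "F \<subseteq> E" "e \<in> F"
  shows "cinner (\<Sum>f\<in>F. c f *\<^sub>C f) e = c e"
proof -
  have "cinner f e = (if f = e then 1 else 0)" if "f \<in> F" for f
    using assms that unfolding orthonormal_def by blast
  then have "cinner (\<Sum>f\<in>F. c f *\<^sub>C f) e = (\<Sum>f\<in>F. if f = e then c f else 0)"
    unfolding cinner_sum_left cinner_scaleC_left by (intro sum.cong) auto
  then show ?thesis using assms by simp
qed

lemma norm_diff_projection:
  fixes x :: "'a::complex_hilbert_space"
  assumes E: "orthonormal E" "finite F" "F \<subseteq> E"
  shows "(norm (x - (\<Sum>e\<in>F. cinner x e *\<^sub>C e)))\<^sup>2 = (norm x)\<^sup>2 - (\<Sum>e\<in>F. (cmod (cinner x e))\<^sup>2)"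
proof -
  let ?p = "\<Sum>e\<in>F. cinner x e *\<^sub>C e"
  have px: "cinner ?p x = of_real (\<Sum>e\<in>F. (cmod (cinner x e))\<^sup>2)"
    unfolding cinner_sum_left cinner_scaleC_left of_real_sum complex_norm_square
    by (intro sum.cong refl arg_cong2[where f = "(*)"] cinner_commute)
  have "cinner ?p ?p = cinner ?p x"
  proof -
    have "cinner ?p ?p = (\<Sum>e\<in>F. cnj (cinner x e) * cinner ?p e)"
      by (simp add: cinner_sum_right[of ?p] cinner_scaleC_right)
    also have "\<dots> = (\<Sum>e\<in>F. cinner e x * cinner x e)"
      using orthonormal_cinner_sum[OF E, of _ "cinner x"]
      by (intro sum.cong refl) (simp add: cinner_commute[of _ x])
    also have "\<dots> = cinner ?p x"
      by (simp add: cinner_sum_left cinner_scaleC_left mult.commute)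
    finally show ?thesis .
  qed
  with px have "?p \<bullet> ?p = (\<Sum>e\<in>F. (cmod (cinner x e))\<^sup>2)" "?p \<bullet> x = (\<Sum>e\<in>F. (cmod (cinner x e))\<^sup>2)"
    by (simp_all only: Re_cinner[symmetric] Re_complex_of_real)
  then show ?thesis
    by (simp add: power2_norm_eq_inner inner_diff_left inner_diff_right inner_commute)
qed

lemma bessel:
  fixes x :: "'a::complex_hilbert_space"
  assumes "orthonormal E" "finite F" "F \<subseteq> E"
  shows "(\<Sum>e\<in>F. (cmod (cinner x e))\<^sup>2) \<le> (norm x)\<^sup>2"
  using norm_diff_projection[OF assms, of x] zero_le_power2[of "norm (x - (\<Sum>e\<in>F. cinner x e *\<^sub>C e))"]
  by linarith

text \<open>A nonzero \<open>y\<close> orthogonal to \<open>E\<close> could be normalised and added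
  to \<open>E\<close>, against maximality.\<close>

lemma orthonormal_basis_total:
  fixes y :: "'a::complex_hilbert_space"
  assumes E: "orthonormal_basis E" and y: "\<And>e. e \<in> E \<Longrightarrow> cinner e y = 0"
  shows "y = 0"
proof (rule ccontr)
  assume nz: "y \<noteq> 0"
  define u where "u = complex_of_real (1 / norm y) *\<^sub>C y"
  have "norm u = 1" using nz by (simp add: u_def norm_scaleC norm_divide)
  then have uu: "cinner u u = 1" by (simp add: cinner_self)
  have eu: "cinner e u = 0" "cinner u e = 0" if "e \<in> E" for e
    using y[OF that] cinner_commute[of u e] by (simp_all add: u_def cinner_scaleC_right)
  have "orthonormal (insert u E)"
    using E uu eu by (auto simp: orthonormal_basis_def orthonormal_def)
  then have "u \<in> E" using E by (auto simp: orthonormal_basis_def)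
  then show False using eu uu by force
qed

lemma orthonormal_basis_approx:
  fixes x :: "'a::complex_hilbert_space"
  assumes E: "orthonormal_basis E" and \<epsilon>: "0 < \<epsilon>"
  shows "\<exists>F. finite F \<and> F \<subseteq> E \<and> norm (x - (\<Sum>e\<in>F. cinner x e *\<^sub>C e)) < \<epsilon>"
proof -
  let ?p = "\<lambda>F x. \<Sum>e\<in>F. cinner x e *\<^sub>C e"
  \<comment> \<open>The linear span of \<open>E\<close>, encoded as the vectors that equal one of
    their finite Fourier sums.\<close>
  define M where "M = {x. \<exists>F. finite F \<and> F \<subseteq> E \<and> x = ?p F x}"
  have on: "orthonormal E" using E by (simp add: orthonormal_basis_def)
  have mono: "x = ?p G x" if "x = ?p F x" "finite G" "F \<subseteq> G" "G \<subseteq> E" for F G x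
  proof -
    have "cinner x e = 0" if e: "e \<in> G - F" for e
    proof -
      have "cinner x e = cinner (?p F x) e" using \<open>x = ?p F x\<close> by simp
      also have "\<dots> = (\<Sum>f\<in>F. cinner x f * cinner f e)" by (simp add: cinner_sum_left cinner_scaleC_left)
      also have "\<dots> = 0"
      proof (intro sum.neutral ballI)
        fix f assume "f \<in> F"
        then have "cinner f e = 0"
          using e \<open>F \<subseteq> G\<close> \<open>G \<subseteq> E\<close> on unfolding orthonormal_def by force
        then show "cinner x f * cinner f e = 0" by simp
      qed
      finally show ?thesis .
    qed
    then have "?p F x = ?p G x"
      using that by (intro sum.mono_neutral_left) auto
    with that(1) show ?thesis by simp
  qed
  have sub: "csubspace M"
    unfolding csubspace_def
  proof (intro conjI ballI allI)
    show "0 \<in> M" unfolding M_def by (rule CollectI, rule exI[of _ "{}"]) simp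
  next
    fix x y assume "x \<in> M" "y \<in> M"
    then obtain F G where F: "finite F" "F \<subseteq> E" "x = ?p F x" and G: "finite G" "G \<subseteq> E" "y = ?p G y"
      unfolding M_def by blast
    have "x = ?p (F \<union> G) x" "y = ?p (F \<union> G) y"
      using F G by (intro mono[OF F(3)] mono[OF G(3)]; auto)+
    then have "x + y = ?p (F \<union> G) (x + y)"
      by (simp add: cinner_add_left scaleC_add_left sum.distrib)
    then show "x + y \<in> M" unfolding M_def using F G by blast
  next
    fix c x assume "x \<in> M"
    then obtain F where F: "finite F" "F \<subseteq> E" "x = ?p F x" unfolding M_def by blast
    have "c *\<^sub>C ?p F x = ?p F (c *\<^sub>C x)"
      by (induction F rule: infinite_finite_induct)
         (simp_all add: scaleC_add_right scaleC_scaleC cinner_scaleC_left)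
    then have "c *\<^sub>C x = ?p F (c *\<^sub>C x)" using F(3) by simp
    then show "c *\<^sub>C x \<in> M" unfolding M_def using F by blast
  qed
  have EM: "e \<in> M" if "e \<in> E" for e
    unfolding M_def using that on by (intro CollectI exI[of _ "{e}"]) (simp add: orthonormal_def)
  have "\<exists>m\<in>M. norm (x - m) < \<epsilon>"
    by (rule csubspace_dense[OF sub _ \<epsilon>]) (metis orthonormal_basis_total[OF E] EM)
  then obtain m F where m: "norm (x - m) < \<epsilon>" and F: "finite F" "F \<subseteq> E" "m = ?p F m"
    unfolding M_def by blast
  \<comment> \<open>As \<open>m\<close> is fixed by the projection onto the span of
    \<open>F\<close>, the error of the Fourier sum of \<open>x\<close> is that of
    \<open>x - m\<close>, which is not longer than \<open>x - m\<close> itself.\<close>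
  have "?p F x - m = ?p F (x - m)"
    using F(3) by (simp add: cinner_diff_left sum_subtractf scaleC_diff_left)
  then have "x - ?p F x = (x - m) - ?p F (x - m)" by (simp add: algebra_simps)
  then have "(norm (x - ?p F x))\<^sup>2 = (norm (x - m))\<^sup>2 - (\<Sum>e\<in>F. (cmod (cinner (x - m) e))\<^sup>2)"
    by (simp only: norm_diff_projection[OF on F(1,2)])
  then have "(norm (x - ?p F x))\<^sup>2 \<le> (norm (x - m))\<^sup>2"
    using sum_nonneg[of F "\<lambda>e. (cmod (cinner (x - m) e))\<^sup>2"] by simp
  then have "norm (x - ?p F x) < \<epsilon>" using m by (meson le_less_trans norm_ge_zero power2_le_imp_le)
  then show ?thesis using F by blast
qed

lemma parseval:
  fixes x :: "'a::complex_hilbert_space"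
  assumes E: "orthonormal_basis E"
  shows "((\<lambda>e. (cmod (cinner x e))\<^sup>2) has_sum (norm x)\<^sup>2) E"
proof -
  let ?f = "\<lambda>e. (cmod (cinner x e))\<^sup>2"
  have on: "orthonormal E" using E by (simp add: orthonormal_basis_def)
  have "bdd_above (sum ?f ` {F. F \<subseteq> E \<and> finite F})"
    by (rule bdd_aboveI2[of _ _ "(norm x)\<^sup>2"]) (auto intro: bessel[OF on])
  then have summ: "?f summable_on E" by (intro nonneg_bdd_above_summable_on) auto
  have "infsum ?f E = (norm x)\<^sup>2"
  proof (rule antisym)
    show "infsum ?f E \<le> (norm x)\<^sup>2"
      by (rule infsum_le_finite_sums[OF summ bessel[OF on]])
    show "(norm x)\<^sup>2 \<le> infsum ?f E"
    proof (rule field_le_epsilon)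
      fix \<epsilon> :: real assume "0 < \<epsilon>"
      then obtain F where F: "finite F" "F \<subseteq> E" "norm (x - (\<Sum>e\<in>F. cinner x e *\<^sub>C e)) < sqrt \<epsilon>"
        using orthonormal_basis_approx[OF E, of "sqrt \<epsilon>" x] by auto
      then have "(norm (x - (\<Sum>e\<in>F. cinner x e *\<^sub>C e)))\<^sup>2 < (sqrt \<epsilon>)\<^sup>2"
        by (intro power_strict_mono) auto
      then have "(norm x)\<^sup>2 - sum ?f F < \<epsilon>"
        using norm_diff_projection[OF on F(1,2), of x] \<open>0 < \<epsilon>\<close> by simp
      moreover have "sum ?f F \<le> infsum ?f E" by (rule finite_sum_le_infsum[OF summ F(1,2)]) simp
      ultimately show "(norm x)\<^sup>2 \<le> infsum ?f E + \<epsilon>" by simp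
    qed
  qed
  then show ?thesis using has_sum_infsum[OF summ] by simp
qed

lemma has_sum_finite_sum:
  fixes f :: "'i \<Rightarrow> 'e \<Rightarrow> 'b::topological_comm_monoid_add"
  assumes "\<And>i. i \<in> I \<Longrightarrow> (f i has_sum s i) E"
  shows "((\<lambda>e. \<Sum>i\<in>I. f i e) has_sum (\<Sum>i\<in>I. s i)) E"
  using assms by (induction I rule: infinite_finite_induct) (auto intro: has_sum_add)

text \<open>Polarisation of Parseval's identity; the vectors \<open>x + y\<close> and
  \<open>x - y\<close> recover the real part of the inner product.\<close>

lemma parseval_inner:
  fixes x y :: "'a::complex_hilbert_space"
  assumes E: "orthonormal_basis E"
  shows "((\<lambda>e. Re (cinner x e * cnj (cinner y e))) has_sum (x \<bullet> y)) E"
proof -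
  have "((\<lambda>e. ((cmod (cinner (x + y) e))\<^sup>2 - (cmod (cinner (x - y) e))\<^sup>2) * (1/4))
    has_sum (((norm (x + y))\<^sup>2 - (norm (x - y))\<^sup>2) * (1/4))) E"
    by (intro has_sum_cmult_left has_sum_diff parseval[OF E])
  moreover have "((norm (x + y))\<^sup>2 - (norm (x - y))\<^sup>2) * (1/4) = x \<bullet> y"
    by (simp add: power2_norm_eq_inner inner_add_left inner_add_right inner_diff_left
        inner_diff_right inner_commute)
  moreover have "((cmod (u + v))\<^sup>2 - (cmod (u - v))\<^sup>2) * (1/4) = Re (u * cnj v)" for u v
    unfolding cmod_power2 by (simp add: power2_eq_square algebra_simps)
  ultimately show ?thesis by (simp only: cinner_add_left cinner_diff_left)
qed

section \<open>Hilbert-Schmidt operators and cyclicity of the trace\<close>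

definition hs_on :: "'a::complex_hilbert_space set \<Rightarrow> 'a bop \<Rightarrow> bool"
  where "hs_on E a \<longleftrightarrow> (\<lambda>e. (norm (app a e))\<^sup>2) summable_on E"

text \<open>Both sums come from the double series of
  \<open>(cmod (cinner (app a e) f))\<^sup>2\<close>: summation over \<open>e\<close> uses Parseval,
  summation over \<open>f\<close> only Bessel, because \<open>F\<close> may fail to be maximal. A
  different basis as \<open>F\<close> gives the change of basis.\<close>

lemma hs_on_adj:
  assumes E: "orthonormal_basis E" and F: "orthonormal F" and a: "hs_on E a"
  shows "hs_on F (adj a)"
    and "(\<Sum>\<^sub>\<infinity>f\<in>F. (norm (app (adj a) f))\<^sup>2) \<le> (\<Sum>\<^sub>\<infinity>e\<in>E. (norm (app a e))\<^sup>2)"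
proof -
  let ?S = "\<Sum>\<^sub>\<infinity>e\<in>E. (norm (app a e))\<^sup>2"
  have bound: "(\<Sum>f\<in>G. (norm (app (adj a) f))\<^sup>2) \<le> ?S" if G: "finite G" "G \<subseteq> F" for G
  proof (rule has_sum_mono)
    show "((\<lambda>e. \<Sum>f\<in>G. (cmod (cinner (app (adj a) f) e))\<^sup>2) has_sum
      (\<Sum>f\<in>G. (norm (app (adj a) f))\<^sup>2)) E"
      by (intro has_sum_finite_sum parseval[OF E])
    show "((\<lambda>e. (norm (app a e))\<^sup>2) has_sum ?S) E" using a by (simp add: hs_on_def)
    show "(\<Sum>f\<in>G. (cmod (cinner (app (adj a) f) e))\<^sup>2) \<le> (norm (app a e))\<^sup>2" for e
    proof -
      have "cmod (cinner (app (adj a) f) e) = cmod (cinner (app a e) f)" for f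
        by (metis adj_adj cinner_app_left cinner_commute complex_mod_cnj)
      then show ?thesis using bessel[OF F G, of "app a e"] by simp
    qed
  qed
  then have "bdd_above (sum (\<lambda>f. (norm (app (adj a) f))\<^sup>2) ` {G. G \<subseteq> F \<and> finite G})"
    by (intro bdd_aboveI2) auto
  then show "hs_on F (adj a)" unfolding hs_on_def by (intro nonneg_bdd_above_summable_on) auto
  then show "(\<Sum>\<^sub>\<infinity>f\<in>F. (norm (app (adj a) f))\<^sup>2) \<le> ?S"
    unfolding hs_on_def by (intro infsum_le_finite_sums bound)
qed

text \<open>The inequality of \<open>hs_on_adj\<close> is used for \<open>a\<close> and again for
  \<open>adj a\<close>.\<close>

lemma infsum_hs_adj:
  assumes E: "orthonormal_basis E" and a: "hs_on E a"
  shows "(\<Sum>\<^sub>\<infinity>e\<in>E. (norm (app (adj a) e))\<^sup>2) = (\<Sum>\<^sub>\<infinity>e\<in>E. (norm (app a e))\<^sup>2)"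
proof -
  have on: "orthonormal E" using E by (simp add: orthonormal_basis_def)
  show ?thesis
    using hs_on_adj[OF E on a] hs_on_adj(2)[OF E on hs_on_adj(1)[OF E on a]] by simp
qed

lemma hs_on_comparison:
  assumes a: "hs_on E a" and "\<And>e. e \<in> E \<Longrightarrow> (norm (app b e))\<^sup>2 \<le> K * (norm (app a e))\<^sup>2"
  shows "hs_on E b"
  unfolding hs_on_def
  by (rule summable_on_comparison_test[OF summable_on_cmult_right[OF a[unfolded hs_on_def], of K]])
     (use assms in auto)

lemma hs_on_add:
  assumes "hs_on E a" "hs_on E b"
  shows "hs_on E (a + b)" "hs_on E (a - b)"
proof -
  have s: "(\<lambda>e. 2 * (norm (app a e))\<^sup>2 + 2 * (norm (app b e))\<^sup>2) summable_on E"
    using assms unfolding hs_on_def by (intro summable_on_add summable_on_cmult_right)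
  have "(norm (x + y))\<^sup>2 + (norm (x - y))\<^sup>2 = 2 * (norm x)\<^sup>2 + 2 * (norm y)\<^sup>2" for x y :: 'a
    by (simp add: power2_norm_eq_inner inner_add_left inner_add_right inner_diff_left
        inner_diff_right inner_commute)
  from this[symmetric] show "hs_on E (a + b)" "hs_on E (a - b)"
    unfolding hs_on_def by (auto intro!: summable_on_comparison_test[OF s])
qed

lemma hs_on_mult_left: "hs_on E a \<Longrightarrow> hs_on E (x * a)"
proof (rule hs_on_comparison)
  fix e
  have "(norm (app x (app a e)))\<^sup>2 \<le> (norm x * norm (app a e))\<^sup>2"
    by (intro power_mono norm_app_le) simp
  then show "(norm (app (x * a) e))\<^sup>2 \<le> (norm x)\<^sup>2 * (norm (app a e))\<^sup>2"
    by (simp add: power_mult_distrib)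
qed

text \<open>Polarisation of \<open>infsum_hs_adj\<close>. The equation is the real part of the
  cyclic property, with the trace of \<open>adj b * a\<close> on the left and that of
  \<open>a * adj b\<close> on the right.\<close>

lemma infsum_hs_inner:
  assumes E: "orthonormal_basis E" and a: "hs_on E a" "hs_on E b"
  shows "(\<lambda>e. app a e \<bullet> app b e) summable_on E"
    and "(\<Sum>\<^sub>\<infinity>e\<in>E. app a e \<bullet> app b e) = (\<Sum>\<^sub>\<infinity>e\<in>E. app (adj a) e \<bullet> app (adj b) e)"
proof -
  have on: "orthonormal E" using E by (simp add: orthonormal_basis_def)
  have sum: "((\<lambda>e. app c e \<bullet> app d e) has_sum
      ((\<Sum>\<^sub>\<infinity>e\<in>E. (norm (app (c + d) e))\<^sup>2) - (\<Sum>\<^sub>\<infinity>e\<in>E. (norm (app (c - d) e))\<^sup>2)) * (1/4)) E"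
    if "hs_on E c" "hs_on E d" for c d
  proof -
    have "app c e \<bullet> app d e = ((norm (app (c + d) e))\<^sup>2 - (norm (app (c - d) e))\<^sup>2) * (1/4)" for e
      by (simp add: power2_norm_eq_inner inner_add_left inner_add_right inner_diff_left
          inner_diff_right inner_commute)
    then show ?thesis
      using hs_on_add[OF that]
      by (simp only: hs_on_def) (intro has_sum_cmult_left has_sum_diff has_sum_infsum)
  qed
  show "(\<lambda>e. app a e \<bullet> app b e) summable_on E" using sum[OF a] by (rule has_sum_imp_summable)
  show "(\<Sum>\<^sub>\<infinity>e\<in>E. app a e \<bullet> app b e) = (\<Sum>\<^sub>\<infinity>e\<in>E. app (adj a) e \<bullet> app (adj b) e)"
    using infsumI[OF sum[OF a]] infsumI[OF sum[OF a[THEN hs_on_adj(1)[OF E on]]]]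
      hs_on_add[OF a, THEN infsum_hs_adj[OF E]]
    by (simp only: adj_add adj_diff)
qed

lemma hs_on_mult_right:
  assumes E: "orthonormal_basis E" and a: "hs_on E a"
  shows "hs_on E (a * x)"
proof -
  have on: "orthonormal E" using E by (simp add: orthonormal_basis_def)
  have "hs_on E (adj x * adj a)" by (intro hs_on_mult_left hs_on_adj[OF E on a])
  from hs_on_adj(1)[OF E on this] show ?thesis by (simp add: adj_mult)
qed

text \<open>
  The cyclic property \<open>tr (r (r x)) = tr ((r x) r)\<close> for a Hilbert-Schmidt operator \<open>r\<close>, for the
  real parts.
\<close>

lemma trace_square_mult:
  assumes E: "orthonormal_basis E" and r: "adj r = r" "hs_on E r"
  shows "(\<lambda>e. cinner (app (r * r * x) e) e) summable_on E"
    and "(\<lambda>e. app x (app r e) \<bullet> app r e) summable_on E"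
    and "Re (\<Sum>\<^sub>\<infinity>e\<in>E. cinner (app (r * r * x) e) e) = (\<Sum>\<^sub>\<infinity>e\<in>E. app x (app r e) \<bullet> app r e)"
proof -
  have c: "cinner (app (r * r * x) e) e = cinner (app (r * x) e) (app r e)" for e
    by (simp add: cinner_app_left[of r "app r _"] r)
  have rx: "hs_on E (r * x)" by (rule hs_on_mult_right[OF E r(2)])
  show summ: "(\<lambda>e. cinner (app (r * r * x) e) e) summable_on E"
  proof (rule Infinite_Sum.abs_summable_summable,
      rule Infinite_Sum.abs_summable_on_comparison_test')
    show "(\<lambda>e. (norm (app (r * x) e))\<^sup>2 + (norm (app r e))\<^sup>2) summable_on E"
      using rx r(2) unfolding hs_on_def by (rule summable_on_add)
    show "cmod (cinner (app (r * r * x) e) e) \<le> (norm (app (r * x) e))\<^sup>2 + (norm (app r e))\<^sup>2" for e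
    proof -
      have "cmod (cinner (app (r * x) e) (app r e)) \<le> norm (app (r * x) e) * norm (app r e)"
        by (rule norm_cinner_le)
      also have "\<dots> \<le> (norm (app (r * x) e))\<^sup>2 + (norm (app r e))\<^sup>2"
        using sum_squares_bound[of "norm (app (r * x) e)" "norm (app r e)"]
          mult_nonneg_nonneg[OF norm_ge_zero norm_ge_zero, of "app (r * x) e" "app r e"]
        by linarith
      finally show ?thesis unfolding c .
    qed
  qed
  \<comment> \<open>Here \<open>adj (r * x)\<close> is \<open>adj x * r\<close>, and a real
    quadratic form does not change when \<open>x\<close> is replaced by its adjoint.\<close>
  have "(\<lambda>e. app (adj (r * x)) e \<bullet> app r e) = (\<lambda>e. app x (app r e) \<bullet> app r e)"
    by (simp add: adj_mult r inner_app_adj)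
  moreover have "hs_on E (adj (r * x))"
    using hs_on_mult_left[OF r(2), of "adj x"] by (simp add: adj_mult r)
  ultimately show "(\<lambda>e. app x (app r e) \<bullet> app r e) summable_on E"
    using infsum_hs_inner(1)[OF E _ r(2)] by metis
  have "Re (\<Sum>\<^sub>\<infinity>e\<in>E. cinner (app (r * r * x) e) e) = (\<Sum>\<^sub>\<infinity>e\<in>E. app (r * x) e \<bullet> app r e)"
    using infsum_Re[OF summ] by (simp only: c Re_cinner)
  also have "\<dots> = (\<Sum>\<^sub>\<infinity>e\<in>E. app (adj (r * x)) e \<bullet> app r e)"
    using infsum_hs_inner(2)[OF E rx r(2)] by (simp only: r(1))
  also have "\<dots> = (\<Sum>\<^sub>\<infinity>e\<in>E. app x (app r e) \<bullet> app r e)"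
    by (simp add: adj_mult r inner_app_adj)
  finally show "Re (\<Sum>\<^sub>\<infinity>e\<in>E. cinner (app (r * r * x) e) e) = (\<Sum>\<^sub>\<infinity>e\<in>E. app x (app r e) \<bullet> app r e)" .
qed

text \<open>The form of \<open>c\<close> at \<open>e\<close> is
  \<open>(norm (app q e))\<^sup>2\<close>, so \<open>c \<le> r * r\<close> compares the two
  Hilbert-Schmidt series term by term. In this way \<open>S b\<close> and \<open>b - S b\<close>
  inherit convergent traces from \<open>b\<close>.\<close>

lemma hs_sqrt_of_le:
  assumes r: "adj r = r" "hs_on E r" and c: "0 \<le> c" "c \<le> r * r"
  shows "\<exists>q. 0 \<le> q \<and> q * q = c \<and> hs_on E q"
proof -
  obtain q where q: "0 \<le> q" "q * q = c" using ex_sqrt_bop[OF c(1)] by blast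
  have "(norm (app q e))\<^sup>2 \<le> 1 * (norm (app r e))\<^sup>2" for e
  proof -
    have "(norm (app p e))\<^sup>2 = app (p * p) e \<bullet> e" if "adj p = p" for p
      by (simp add: power2_norm_eq_inner inner_app_left[of p "app p e"] that)
    from this[of q] this[of r] show ?thesis
      using c(2) by (simp add: adj_nonneg[OF q(1)] q(2) r(1) less_eq_bop_iff)
  qed
  then show ?thesis using hs_on_comparison[OF r(2)] q by blast
qed

text \<open>Membership in \<open>trace_class\<close> supplies some basis \<open>E\<close>. It
  justifies the choice behind \<open>some_onb\<close>, and \<open>hs_on_adj\<close> carries the
  Hilbert-Schmidt property of the self-adjoint \<open>r\<close> from \<open>E\<close> to
  \<open>some_onb\<close>.\<close>

lemma trace_class_sqrt:
  assumes b: "b \<in> trace_class" "0 \<le> b"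
  shows "orthonormal_basis (some_onb :: 'a::complex_hilbert_space set)"
    and "\<exists>r. 0 \<le> r \<and> r * r = (b :: 'a bop) \<and> hs_on some_onb r"
proof -
  obtain E where E: "orthonormal_basis E" "(\<lambda>e. Re (cinner (app b e) e)) summable_on E"
    using b by (auto simp: trace_class_def abs_bop_nonneg)
  show onb: "orthonormal_basis (some_onb :: 'a set)"
    unfolding some_onb_def by (rule someI[where P = orthonormal_basis, OF E(1)])
  obtain r where r: "0 \<le> r" "r * r = b" using ex_sqrt_bop[OF b(2)] by blast
  have "(norm (app r e))\<^sup>2 = Re (cinner (app b e) e)" for e
    by (simp add: r(2)[symmetric] Re_cinner power2_norm_eq_inner inner_app_left[of r "app r e"]
        adj_nonneg[OF r(1)])
  then have "hs_on E r" using E(2) by (simp add: hs_on_def)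
  then have "hs_on some_onb (adj r)"
    using onb by (intro hs_on_adj[OF E(1)]) (simp_all add: orthonormal_basis_def)
  then show "\<exists>r. 0 \<le> r \<and> r * r = b \<and> hs_on some_onb r"
    using r adj_nonneg[OF r(1)] by auto
qed


section \<open>Positive unital maps\<close>

lemma clinear_scaleR:
  assumes "clinear (T :: 'a::complex_vector \<Rightarrow> 'b::complex_vector)"
  shows "T (r *\<^sub>R x) = r *\<^sub>R T x"
  using assms by (simp add: clinear_iff scaleR_scaleC)

lemma clinear_diff:
  assumes "clinear (T :: 'a::complex_vector \<Rightarrow> 'b::complex_vector)"
  shows "T (x - y) = T x - T y"
  using assms unfolding clinear_iff by (metis add_diff_cancel diff_add_cancel)

lemma clinear_sum:
  assumes "clinear (T :: 'a::complex_vector \<Rightarrow> 'b::complex_vector)"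
  shows "T (sum f A) = (\<Sum>i\<in>A. T (f i))"
proof -
  have "T 0 = 0" using clinear_diff[OF assms, of 0 0] by simp
  then show ?thesis
    using assms by (induction A rule: infinite_finite_induct) (auto simp: clinear_iff)
qed

lemma linear_of_clinear:
  assumes "clinear (T :: 'a::complex_vector \<Rightarrow> 'b::complex_vector)"
  shows "linear T"
  using assms by (intro linearI) (auto simp: clinear_iff clinear_scaleR[OF assms])

lemma clinear_inv:
  fixes T :: "'a::complex_vector \<Rightarrow> 'b::complex_vector"
  assumes T: "clinear T" and bij: "bij T"
  shows "clinear (inv T)"
proof -
  have [simp]: "T (inv T x) = x" for x using bij by (simp add: bij_is_surj surj_f_inv_f)
  show ?thesis
    using T unfolding clinear_iff by (auto intro!: inv_f_eq[OF bij_is_inj[OF bij]])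
qed

lemma positive_map_mono:
  assumes "clinear T" "positive_map T" "x \<le> y"
  shows "T x \<le> T y"
proof -
  have "0 \<le> T (y - x)" using assms by (simp add: positive_map_def)
  then show ?thesis by (simp add: clinear_diff[OF assms(1)])
qed

text \<open>The operator \<open>h\<close> is the difference of the positive operators
  \<open>norm h *\<^sub>R 1\<close> and \<open>norm h *\<^sub>R 1 - h\<close>.\<close>

lemma positive_map_hermitian:
  fixes T :: "'a::complex_hilbert_space bop \<Rightarrow> 'a bop"
  assumes T: "clinear T" "positive_map T" and h: "adj h = h"
  shows "adj (T h) = T h"
proof -
  have "0 \<le> norm h *\<^sub>R (1 :: 'a bop)" "0 \<le> norm h *\<^sub>R 1 - h"
    using le_norm_scaleR_one[OF h] by (simp_all add: nonneg_scaleR_bop one_bop_nonneg)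
  then have "0 \<le> T (norm h *\<^sub>R 1)" "0 \<le> T (norm h *\<^sub>R 1 - h)"
    using T(2) by (simp_all only: positive_map_def)
  from this[THEN adj_nonneg] have "adj (T (norm h *\<^sub>R 1) - T (norm h *\<^sub>R 1 - h)) = T (norm h *\<^sub>R 1) - T (norm h *\<^sub>R 1 - h)"
    by (simp add: adj_diff)
  then show ?thesis by (simp add: clinear_diff[OF T(1), symmetric])
qed

lemma hermitian_decomposition:
  fixes x :: "'a::complex_hilbert_space bop"
  obtains h k where "adj h = h" "adj k = k" "x = h + \<i> *\<^sub>C k" "adj x = h - \<i> *\<^sub>C k"
proof
  let ?h = "(1/2) *\<^sub>C (x + adj x)" and ?k = "(- \<i>/2) *\<^sub>C (x - adj x)"
  show "adj ?h = ?h" by (simp add: adj_scaleC adj_add add.commute)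
  have "(- \<i>/2) *\<^sub>C (x - adj x) = (\<i>/2) *\<^sub>C (adj x - x)"
    by (simp add: scaleC_diff_right scaleC_minus_left)
  then show "adj ?k = ?k" by (simp add: adj_scaleC adj_diff)
  have ik: "\<i> *\<^sub>C ?k = (1/2) *\<^sub>C (x - adj x)" by (simp add: scaleC_scaleC)
  have half: "(1/2) *\<^sub>C y + (1/2) *\<^sub>C y = y" for y :: "'a bop"
    by (simp flip: scaleC_add_left)
  show "x = ?h + \<i> *\<^sub>C ?k" "adj x = ?h - \<i> *\<^sub>C ?k"
    using half[of x] half[of "adj x"] unfolding ik
    by (simp_all add: scaleC_add_right scaleC_diff_right algebra_simps)
qed

lemma positive_map_adj:
  fixes T :: "'a::complex_hilbert_space bop \<Rightarrow> 'a bop"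
  assumes T: "clinear T" "positive_map T"
  shows "T (adj x) = adj (T x)"
proof -
  obtain h k where hk: "adj h = h" "adj k = k" and x: "x = h + \<i> *\<^sub>C k" "adj x = h - \<i> *\<^sub>C k"
    by (rule hermitian_decomposition)
  have "T (adj x) = T h - \<i> *\<^sub>C T k"
    using T(1) unfolding x(2) by (simp add: clinear_diff[OF T(1)] clinear_iff)
  moreover have "adj (T x) = T h - \<i> *\<^sub>C T k"
  proof -
    have "T x = T h + \<i> *\<^sub>C T k" using T(1) unfolding x(1) by (simp add: clinear_iff)
    then have "adj (T x) = T h + (- \<i>) *\<^sub>C T k"
      by (simp add: adj_add adj_scaleC positive_map_hermitian[OF T] hk)
    then show ?thesis by (simp add: scaleC_minus_left)
  qed
  ultimately show ?thesis by simp
qed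

text \<open>
  Fejer's kernel: with \<open>s k = (1 + x + \<dots> + x ^ k) \<xi>\<close> one has \<open>s (k + 1) - \<xi> = x (s k)\<close>, so
  \<open>norm (s (k + 1) - \<xi>) \<le> norm (s k)\<close>, and these inequalities telescope.
\<close>

lemma fejer_nonneg:
  fixes x :: "'a::complex_hilbert_space bop"
  assumes x: "norm x \<le> 1"
  shows "0 \<le> (\<Sum>k\<le>M. (\<Sum>n\<le>k. x ^ n) + adj (\<Sum>n\<le>k. x ^ n) - 1)"
proof -
  define A where "A k = (\<Sum>n\<le>k. x ^ n)" for k
  have A_Suc: "A (Suc k) = 1 + x * A k" for k
    unfolding A_def by (simp add: sum.atMost_Suc_shift sum_distrib_left del: sum.atMost_Suc)
  have tele: "(norm (app (A M) \<xi>))\<^sup>2 \<le> (\<Sum>k\<le>M. 2 * (app (A k) \<xi> \<bullet> \<xi>) - (norm \<xi>)\<^sup>2)" for \<xi>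
  proof (induction M)
    case 0
    then show ?case by (simp add: A_def power2_norm_eq_inner)
  next
    case (Suc M)
    have "norm (app x (app (A M) \<xi>)) \<le> norm (app (A M) \<xi>)"
      using order_trans[OF norm_app_le mult_right_mono[OF x norm_ge_zero]] by simp
    then have "(norm (app (A (Suc M)) \<xi> - \<xi>))\<^sup>2 \<le> (norm (app (A M) \<xi>))\<^sup>2"
      by (simp add: A_Suc)
    then have "(norm (app (A (Suc M)) \<xi>))\<^sup>2 + (norm \<xi>)\<^sup>2 - 2 * (app (A (Suc M)) \<xi> \<bullet> \<xi>)
        \<le> (norm (app (A M) \<xi>))\<^sup>2"
      by (simp add: power2_norm_eq_inner inner_diff_left inner_diff_right inner_commute)
    then show ?case using Suc by simp
  qed
  have "0 \<le> (\<Sum>k\<le>M. 2 * (app (A k) \<xi> \<bullet> \<xi>) - (norm \<xi>)\<^sup>2)" for \<xi>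
    by (rule order_trans[OF zero_le_power2 tele])
  moreover have "app (\<Sum>k\<le>M. A k + adj (A k) - 1) \<xi> \<bullet> \<xi>
      = (\<Sum>k\<le>M. 2 * (app (A k) \<xi> \<bullet> \<xi>) - (norm \<xi>)\<^sup>2)" for \<xi>
    by (simp add: app_sum_bop inner_sum_left inner_diff_left inner_add_left inner_app_adj
        power2_norm_eq_inner)
  ultimately have "0 \<le> (\<Sum>k\<le>M. A k + adj (A k) - 1)"
    by (simp add: nonneg_bop_iff adj_sum adj_diff adj_add add.commute)
  then show ?thesis by (simp add: A_def)
qed

text \<open>A geometric sum with ratio \<open>w \<noteq> 1\<close> and \<open>w ^ N = 1\<close>. It
  extracts Fourier coefficients exactly by finite averages, in place of integrals over the
  circle.\<close>

lemma sum_powers_roots_of_unity: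
  assumes "0 < n" "n < N"
  shows "(\<Sum>j<N. cis (2 * pi * real j / real N) ^ n) = 0"
proof -
  define w where "w = cis (2 * pi * real n / real N)"
  have "cis (2 * pi * real j / real N) ^ n = w ^ j" for j
    by (simp add: w_def Complex.DeMoivre field_simps)
  moreover have "w \<noteq> 1"
  proof
    assume "w = 1"
    then have "cos (2 * pi * real n / real N) = 1" by (simp add: w_def complex_eq_iff)
    then obtain m :: int where "2 * pi * real n / real N = of_int m * 2 * pi"
      by (auto simp: cos_one_2pi_int)
    then have "real n = of_int m * real N" using assms by (simp add: field_simps)
    then have "int n = m * int N" by (metis of_int_eq_iff of_int_mult of_int_of_nat_eq)
    then have "int N dvd int n" by simp
    then show False using assms by (auto dest: dvd_imp_le)
  qed
  moreover have "w ^ N = 1"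
    using assms cis_multiple_2pi[of "real n"] by (simp add: w_def Complex.DeMoivre)
  ultimately show ?thesis by (simp add: geometric_sum)
qed

lemma scaleC_power_bop: "(c *\<^sub>C x) ^ n = c ^ n *\<^sub>C (x :: 'a::complex_hilbert_space bop) ^ n"
proof -
  have "(c *\<^sub>C y) * (d *\<^sub>C z) = (c * d) *\<^sub>C (y * z)" for c d and y z :: "'a bop"
    by (rule bop_eqI) (simp add: scaleC_scaleC mult.commute)
  then show ?thesis by (induction n) simp_all
qed

lemma scaleC_sum_left: "sum f A *\<^sub>C x = (\<Sum>i\<in>A. f i *\<^sub>C (x::'a::complex_vector))"
  by (induction A rule: infinite_finite_induct)
     (simp_all add: scaleC_add_left)

lemma scaleC_sum_right: "c *\<^sub>C sum f A = (\<Sum>i\<in>A. c *\<^sub>C (f i::'a::complex_vector))"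
  by (induction A rule: infinite_finite_induct) (simp_all add: scaleC_add_right)

text \<open>
  The Russo-Dye theorem. A contraction \<open>x\<close> is, up to the factor \<open>M / (M + 1)\<close>, an average of
  phases times the positive operators \<open>F j\<close>, Fejer kernels of rotations of \<open>x\<close>, whose plain
  average is a multiple of the identity.
\<close>

lemma positive_unital_contraction:
  fixes T :: "'a::complex_hilbert_space bop \<Rightarrow> 'a bop"
  assumes T: "clinear T" "positive_map T" "T 1 = 1" and x: "norm x \<le> 1"
  shows "norm (T x) \<le> 1"
proof (rule norm_bop_le_form)
  fix \<xi> \<eta> :: 'a
  let ?B = "((norm \<xi>)\<^sup>2 + (norm \<eta>)\<^sup>2) / 2"
  \<comment> \<open>Division by \<open>real M\<close> and large \<open>M\<close> give the claimed
    bound.\<close>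
  have main: "real M * (app (T x) \<xi> \<bullet> \<eta>) \<le> (real M + 1) * ?B" for M
  proof -
    \<comment> \<open>Exponents up to \<open>M + 1\<close> occur, since averaging with phases
      multiplies by \<open>cnj (c j)\<close> once more. All of them stay below \<open>N\<close>, so
      a power averages to zero unless its exponent is zero.\<close>
    define N where "N = M + 2"
    have lt: "n < N" if "n \<le> Suc M" for n using that by (simp add: N_def)
    define c where "c j = cis (2 * pi * real j / real N)" for j
    have norm_c: "cmod (c j) = 1" for j by (simp add: c_def)
    have cnj_c: "cnj (c j) * c j = 1" for j
      using complex_norm_square[of "c j"] by (simp add: norm_c mult.commute)
    have root: "(\<Sum>j<N. c j ^ n) = (if n = 0 then of_nat N else 0)" if "n < N" for n
      using sum_powers_roots_of_unity[of n N] that by (auto simp: c_def)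
    have root': "(\<Sum>j<N. cnj (c j) ^ n) = (if n = 0 then of_nat N else 0)" if "n < N" for n
      using arg_cong[OF root[OF that], of cnj] by (auto simp: cnj_sum)
    have root1: "(\<Sum>j<N. cnj (c j) * c j ^ n) = (if n = 1 then of_nat N else 0)" if "n < N" for n
    proof (cases n)
      case 0
      then show ?thesis using root'[OF lt, of 1] by simp
    next
      case (Suc m)
      have "cnj (c j) * c j ^ n = c j ^ m" for j
        by (simp only: Suc power_Suc mult.assoc[symmetric] cnj_c mult_1)
      then show ?thesis using root[of m] that Suc by (simp only:) auto
    qed
    define F where "F j = (\<Sum>k\<le>M. (\<Sum>n\<le>k. (c j *\<^sub>C x) ^ n) + adj (\<Sum>n\<le>k. (c j *\<^sub>C x) ^ n) - 1)" for j
    have F_nonneg: "0 \<le> F j" for j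
      unfolding F_def
    proof (rule fejer_nonneg, rule norm_bop_le)
      show "norm (app (c j *\<^sub>C x) \<xi>) \<le> 1 * norm \<xi>" for \<xi>
        using order_trans[OF norm_app_le mult_right_mono[OF x norm_ge_zero], of \<xi>]
        by (simp add: norm_scaleC norm_c)
    qed simp
    have F_eq: "d *\<^sub>C F j = (\<Sum>k\<le>M. (\<Sum>n\<le>k. (d * c j ^ n) *\<^sub>C x ^ n)
        + (\<Sum>n\<le>k. (d * cnj (c j) ^ n) *\<^sub>C adj x ^ n) - d *\<^sub>C 1)" for d j
      by (simp add: F_def scaleC_power_bop adj_sum adj_scaleC adj_power scaleC_sum_right
          scaleC_add_right scaleC_diff_right scaleC_scaleC)
    have sum_F: "(\<Sum>j<N. d j *\<^sub>C F j) = (\<Sum>k\<le>M. (\<Sum>n\<le>k. (\<Sum>j<N. d j * c j ^ n) *\<^sub>C x ^ n)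
        + (\<Sum>n\<le>k. (\<Sum>j<N. d j * cnj (c j) ^ n) *\<^sub>C adj x ^ n) - (\<Sum>j<N. d j) *\<^sub>C 1)" for d
      unfolding F_eq scaleC_sum_left
      by (subst sum.swap) (simp add: sum.distrib sum_subtractf sum.swap[of _ _ "{..<N}"])
    \<comment> \<open>Only the exponent 0 survives; it contributes \<open>N + N - N\<close> for each
      of the \<open>M + 1\<close> values of \<open>k\<close>.\<close>
    have average: "(\<Sum>j<N. F j) = complex_of_real (real N * (real M + 1)) *\<^sub>C 1"
    proof -
      have "(\<Sum>n\<le>k. (\<Sum>j<N. c j ^ n) *\<^sub>C y ^ n) = of_nat N *\<^sub>C 1"
        "(\<Sum>n\<le>k. (\<Sum>j<N. cnj (c j) ^ n) *\<^sub>C y ^ n) = of_nat N *\<^sub>C 1"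
        if "k \<le> M" for k and y :: "'a bop"
      proof -
        have "(\<Sum>n\<le>k. (\<Sum>j<N. c j ^ n) *\<^sub>C y ^ n) = (\<Sum>n\<le>k. if n = 0 then of_nat N *\<^sub>C 1 else 0)"
          "(\<Sum>n\<le>k. (\<Sum>j<N. cnj (c j) ^ n) *\<^sub>C y ^ n) = (\<Sum>n\<le>k. if n = 0 then of_nat N *\<^sub>C 1 else 0)"
          using that by (intro sum.cong refl; simp add: root root' lt)+
        then show "(\<Sum>n\<le>k. (\<Sum>j<N. c j ^ n) *\<^sub>C y ^ n) = of_nat N *\<^sub>C 1"
          "(\<Sum>n\<le>k. (\<Sum>j<N. cnj (c j) ^ n) *\<^sub>C y ^ n) = of_nat N *\<^sub>C 1"
          by simp_all
      qed
      then have "(\<Sum>j<N. 1 *\<^sub>C F j) = (\<Sum>k\<le>M. of_nat N *\<^sub>C 1)"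
        unfolding sum_F by (intro sum.cong refl) simp
      also have "\<dots> = (\<Sum>k\<le>M. of_nat N) *\<^sub>C 1" by (simp only: scaleC_sum_left)
      finally show ?thesis by (simp add: mult.commute add.commute)
    qed
    \<comment> \<open>Only the first power of \<open>x\<close> survives. It is absent for
      \<open>k = 0\<close>, which leaves \<open>M\<close> terms and explains the factor
      \<open>M / (M + 1)\<close>.\<close>
    have phases: "(\<Sum>j<N. cnj (c j) *\<^sub>C F j) = complex_of_real (real N * real M) *\<^sub>C x"
    proof -
      have "(\<Sum>n\<le>k. (\<Sum>j<N. cnj (c j) * c j ^ n) *\<^sub>C x ^ n) = (if k = 0 then 0 else of_nat N *\<^sub>C x)"
        if "k \<le> M" for k
      proof -
        have "(\<Sum>n\<le>k. (\<Sum>j<N. cnj (c j) * c j ^ n) *\<^sub>C x ^ n) = (\<Sum>n\<le>k. if n = 1 then of_nat N *\<^sub>C x else 0)"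
          using that by (intro sum.cong refl) (simp add: root1 lt)
        then show ?thesis by simp
      qed
      moreover have "(\<Sum>n\<le>k. (\<Sum>j<N. cnj (c j) * cnj (c j) ^ n) *\<^sub>C adj x ^ n) = 0" if "k \<le> M" for k
        using that root'[OF lt, of "Suc _"] by (intro sum.neutral) simp
      moreover have "(\<Sum>j<N. cnj (c j)) = 0" using root'[OF lt, of 1] by simp
      ultimately have "(\<Sum>j<N. cnj (c j) *\<^sub>C F j) = (\<Sum>k\<le>M. if k = 0 then 0 else of_nat N *\<^sub>C x)"
        unfolding sum_F by (intro sum.cong refl) simp
      also have "\<dots> = (\<Sum>k\<in>{1..M}. of_nat N *\<^sub>C x)"
        by (rule sum.mono_neutral_cong_right) auto
      also have "\<dots> = (\<Sum>k\<in>{1..M}. of_nat N) *\<^sub>C x" by (simp only: scaleC_sum_left)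
      finally show ?thesis by (simp add: mult.commute)
    qed
    have TF: "0 \<le> T (F j)" for j using T(2) F_nonneg by (simp add: positive_map_def)
    have T_average: "(\<Sum>j<N. app (T (F j)) \<zeta> \<bullet> \<zeta>) = real N * (real M + 1) * (norm \<zeta>)\<^sup>2" for \<zeta>
    proof -
      have "(\<Sum>j<N. T (F j)) = (real N * (real M + 1)) *\<^sub>R 1"
        using arg_cong[OF average, of T] T(1,3)
        by (simp add: clinear_sum[OF T(1)] scaleR_bop_def clinear_iff)
      from arg_cong[OF this, of "\<lambda>y. app y \<zeta> \<bullet> \<zeta>"] show ?thesis
        by (simp add: app_sum_bop inner_sum_left power2_norm_eq_inner)
    qed
    have "(\<Sum>j<N. cnj (c j) *\<^sub>C T (F j)) = (real N * real M) *\<^sub>R T x"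
      using arg_cong[OF phases, of T] T(1)
      by (simp add: clinear_sum[OF T(1)] scaleR_bop_def clinear_iff)
    from arg_cong[OF this, of "\<lambda>y. app y \<xi> \<bullet> \<eta>"]
    have "real N * (real M * (app (T x) \<xi> \<bullet> \<eta>)) = (\<Sum>j<N. app (T (F j)) (cnj (c j) *\<^sub>C \<xi>) \<bullet> \<eta>)"
      by (simp add: app_sum_bop inner_sum_left)
    also have "\<dots> \<le> (\<Sum>j<N. (app (T (F j)) \<xi> \<bullet> \<xi> + app (T (F j)) \<eta> \<bullet> \<eta>) / 2)"
    proof (rule sum_mono)
      fix j
      \<comment> \<open>The phase has modulus 1 and cancels in the diagonal form, so the sum of the
        upper bounds is governed by the plain average.\<close>
      have "app (T (F j)) (cnj (c j) *\<^sub>C \<xi>) \<bullet> (cnj (c j) *\<^sub>C \<xi>) = app (T (F j)) \<xi> \<bullet> \<xi>"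
        by (simp only: Re_cinner[symmetric] app_scaleC cinner_scaleC_left cinner_scaleC_right
            complex_cnj_cnj mult.assoc[symmetric] mult.commute[of "c j"] cnj_c mult_1)
      then show "app (T (F j)) (cnj (c j) *\<^sub>C \<xi>) \<bullet> \<eta> \<le> (app (T (F j)) \<xi> \<bullet> \<xi> + app (T (F j)) \<eta> \<bullet> \<eta>) / 2"
        using inner_app_le_average[OF TF, of j "cnj (c j) *\<^sub>C \<xi>" \<eta>] by simp
    qed
    also have "\<dots> = real N * ((real M + 1) * ?B)"
      by (simp only: sum_divide_distrib[symmetric] sum.distrib T_average) (simp add: algebra_simps)
    finally show ?thesis by (simp add: N_def)
  qed
  show "app (T x) \<xi> \<bullet> \<eta> \<le> 1 * ((norm \<xi>)\<^sup>2 + (norm \<eta>)\<^sup>2) / 2"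
  proof (rule ccontr)
    assume "\<not> ?thesis"
    then have "0 < app (T x) \<xi> \<bullet> \<eta> - ?B" by simp
    then obtain M where M: "?B < of_nat M * (app (T x) \<xi> \<bullet> \<eta> - ?B)"
      using ex_less_of_nat_mult by blast
    have "False" if "B < m * (q - B)" "m * q \<le> (m + 1) * B" for B m q :: real
      using that by (simp add: algebra_simps)
    from this[OF M main] show False .
  qed
qed simp

lemma positive_unital_norm_le:
  fixes T :: "'a::complex_hilbert_space bop \<Rightarrow> 'a bop"
  assumes T: "clinear T" "positive_map T" "T 1 = 1"
  shows "norm (T x) \<le> norm x"
proof (cases "x = 0")
  case True
  then show ?thesis using clinear_diff[OF T(1), of 0 0] by simp
next
  case False
  then show ?thesis
    using positive_unital_contraction[OF T, of "inverse (norm x) *\<^sub>R x"]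
    by (simp add: clinear_scaleR[OF T(1)] field_simps)
qed

text \<open>
  For \<open>x \<ge> 0\<close> the numbers \<open>cinner (L x \<xi>) \<xi>\<close> are real because
  \<open>(norm (x + \<i> t))\<^sup>2 \<le> (norm x)\<^sup>2 + t\<^sup>2\<close> for all real \<open>t\<close>,
  and nonnegative because \<open>norm (norm x - x) \<le> norm x\<close>.
\<close>

lemma unital_contraction_positive:
  fixes L :: "'a::complex_hilbert_space bop \<Rightarrow> 'a bop"
  assumes L: "clinear L" "L 1 = 1" and contr: "\<And>x. norm (L x) \<le> norm x"
  shows "positive_map L"
  unfolding positive_map_def
proof (intro allI impI)
  fix x :: "'a bop"
  assume x: "0 \<le> x"
  define s where "s = norm x"
  have form: "cmod (cinner (app (L y) \<xi>) \<xi>) \<le> norm y * (norm \<xi>)\<^sup>2" for y \<xi>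
  proof -
    have "cmod (cinner (app (L y) \<xi>) \<xi>) \<le> norm (L y) * norm \<xi> * norm \<xi>"
      by (rule order_trans[OF norm_cinner_le mult_right_mono[OF norm_app_le norm_ge_zero]])
    also have "\<dots> \<le> norm y * (norm \<xi>)\<^sup>2"
      using mult_right_mono[OF contr[of y] zero_le_power2[of "norm \<xi>"]]
      by (simp add: power2_eq_square mult.assoc)
    finally show ?thesis .
  qed
  have Im0: "Im (cinner (app (L x) \<xi>) \<xi>) = 0" for \<xi>
  proof (cases "\<xi> = 0")
    case False
    define n where "n = (norm \<xi>)\<^sup>2"
    define \<beta> where "\<beta> = Im (cinner (app (L x) \<xi>) \<xi>)"
    have n: "0 < n" using False by (simp add: n_def)
    \<comment> \<open>Squaring \<open>\<bar>\<beta> + t * n\<bar> \<le> sqrt (s\<^sup>2 + t\<^sup>2)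
      * n\<close> cancels the terms quadratic in \<open>t\<close>; the remainder is linear in
      \<open>t\<close> and bounded above, which forces \<open>\<beta> = 0\<close>.\<close>
    have ineq: "\<beta>\<^sup>2 + 2 * t * (\<beta> * n) \<le> s\<^sup>2 * n\<^sup>2" for t
    proof -
      let ?y = "x + (\<i> * complex_of_real t) *\<^sub>C 1"
      have "norm ?y \<le> sqrt (s\<^sup>2 + t\<^sup>2)"
      proof (rule norm_bop_le)
        fix \<zeta>
        have "Re (cinner (app x \<zeta>) \<zeta> * cnj (\<i> * complex_of_real t)) = 0"
        proof -
          have "cinner (app x \<zeta>) \<zeta> = cnj (cinner (app x \<zeta>) \<zeta>)"
            by (metis cinner_app_left cinner_commute adj_nonneg[OF x])
          then have "Im (cinner (app x \<zeta>) \<zeta>) = 0" by (simp add: complex_eq_iff)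
          then show ?thesis by simp
        qed
        then have orth: "app x \<zeta> \<bullet> ((\<i> * complex_of_real t) *\<^sub>C \<zeta>) = 0"
          by (simp add: Re_cinner[symmetric] cinner_scaleC_right mult.commute)
        have "(norm (app ?y \<zeta>))\<^sup>2 = (norm (app x \<zeta>))\<^sup>2 + (norm ((\<i> * complex_of_real t) *\<^sub>C \<zeta>))\<^sup>2"
          using orth by (simp add: power2_norm_eq_inner inner_add_left inner_add_right inner_commute)
        also have "\<dots> \<le> (s * norm \<zeta>)\<^sup>2 + (\<bar>t\<bar> * norm \<zeta>)\<^sup>2"
          by (intro add_mono power_mono) (simp_all add: s_def norm_app_le norm_scaleC norm_mult)
        also have "\<dots> = (sqrt (s\<^sup>2 + t\<^sup>2) * norm \<zeta>)\<^sup>2"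
          by (simp add: power_mult_distrib algebra_simps)
        finally show "norm (app ?y \<zeta>) \<le> sqrt (s\<^sup>2 + t\<^sup>2) * norm \<zeta>"
          by (rule power2_le_imp_le) simp
      qed simp
      then have "cmod (cinner (app (L ?y) \<xi>) \<xi>) \<le> sqrt (s\<^sup>2 + t\<^sup>2) * n"
        using order_trans[OF form mult_right_mono] by (simp add: n_def)
      moreover have "Im (cinner (app (L ?y) \<xi>) \<xi>) = \<beta> + t * n"
        using L by (simp add: clinear_iff cinner_add_left cinner_scaleC_left \<beta>_def n_def cinner_self
            del: of_real_power)
      ultimately have "\<bar>\<beta> + t * n\<bar> \<le> sqrt (s\<^sup>2 + t\<^sup>2) * n"
        by (metis abs_Im_le_cmod order_trans)
      then have "(\<beta> + t * n)\<^sup>2 \<le> (sqrt (s\<^sup>2 + t\<^sup>2) * n)\<^sup>2" by (rule abs_le_square_iff[THEN iffD1, OF order_trans]) simp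
      then show ?thesis by (simp add: power_mult_distrib power2_sum algebra_simps)
    qed
    have "\<beta> = 0"
    proof (rule ccontr)
      assume nz: "\<beta> \<noteq> 0"
      \<comment> \<open>This \<open>t\<close> makes the linear term equal to the right-hand
        side.\<close>
      have "\<beta>\<^sup>2 + 2 * ((s\<^sup>2 * n\<^sup>2) / (2 * (\<beta> * n))) * (\<beta> * n) \<le> s\<^sup>2 * n\<^sup>2" by (rule ineq)
      then have "\<beta>\<^sup>2 \<le> 0" using nz n by simp
      then show False using nz by simp
    qed
    then show ?thesis by (simp add: \<beta>_def)
  qed simp
  have Re_nonneg: "0 \<le> app (L x) \<xi> \<bullet> \<xi>" for \<xi>
  proof -
    have "norm (s *\<^sub>R 1 - x) \<le> s"
    proof (rule norm_nonneg_bop_le)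
      show "0 \<le> s *\<^sub>R 1 - x" using le_norm_scaleR_one[OF adj_nonneg[OF x]] by (simp add: s_def)
      show "app (s *\<^sub>R 1 - x) \<zeta> \<bullet> \<zeta> \<le> s * (norm \<zeta>)\<^sup>2" for \<zeta>
        using x by (simp add: nonneg_bop_iff inner_diff_left power2_norm_eq_inner)
    qed (simp add: s_def)
    then have "cmod (cinner (app (L (s *\<^sub>R 1 - x)) \<xi>) \<xi>) \<le> s * (norm \<xi>)\<^sup>2"
      using order_trans[OF form mult_right_mono] by simp
    then have "app (L (s *\<^sub>R 1 - x)) \<xi> \<bullet> \<xi> \<le> s * (norm \<xi>)\<^sup>2"
      using complex_Re_le_cmod[of "cinner (app (L (s *\<^sub>R 1 - x)) \<xi>) \<xi>"] by (simp add: Re_cinner)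
    then show ?thesis
      by (simp add: clinear_diff[OF L(1)] clinear_scaleR[OF L(1)] L(2) inner_diff_left power2_norm_eq_inner)
  qed
  have "adj (L x) = L x"
  proof -
    \<comment> \<open>Up to a real factor this is the imaginary part of \<open>L x\<close>. Its form
      vanishes, so antisymmetry of the order gives \<open>d = 0\<close>.\<close>
    define d where "d = \<i> *\<^sub>C (L x - adj (L x))"
    have "adj d = d"
    proof -
      have "adj d = (- \<i>) *\<^sub>C (adj (L x) - L x)" by (simp add: d_def adj_scaleC adj_diff)
      also have "\<dots> = d" by (simp add: d_def scaleC_diff_right scaleC_minus_left)
      finally show ?thesis .
    qed
    moreover have "app d \<xi> \<bullet> \<xi> = 0" for \<xi>
    proof -
      have "cinner (app (adj (L x)) \<xi>) \<xi> = cnj (cinner (app (L x) \<xi>) \<xi>)"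
        by (metis cinner_app_right cinner_commute)
      also have "\<dots> = cinner (app (L x) \<xi>) \<xi>" by (simp add: complex_eq_iff Im0)
      finally show ?thesis
        by (simp add: d_def Re_cinner[symmetric] cinner_scaleC_left cinner_diff_left)
    qed
    ultimately have "0 \<le> d" "d \<le> 0" by (simp_all add: nonneg_bop_iff less_eq_bop_iff adj_minus)
    then have "d = 0" by simp
    then have "(- \<i>) *\<^sub>C d = 0" by simp
    then show ?thesis by (simp add: d_def scaleC_scaleC)
  qed
  then show "0 \<le> L x" using Re_nonneg by (simp add: nonneg_bop_iff)
qed

lemma bij_isometry_doubly_power_bounded:
  fixes T :: "'a::{complex_vector, real_normed_vector} \<Rightarrow> 'a"
  assumes T: "clinear T" "bij T" and iso: "\<And>x. norm (T x) = norm x"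
  shows "doubly_power_bounded T"
proof -
  have iso': "norm (inv T x) = norm x" for x
    using iso[of "inv T x"] T(2) by (simp add: bij_is_surj surj_f_inv_f)
  have pow: "linear (f ^^ n) \<and> (\<forall>x. norm ((f ^^ n) x) = norm x)"
    if "linear f" "\<And>x. norm (f x) = norm x" for f :: "'a \<Rightarrow> 'a" and n
    using that by (induction n) (auto simp: linear_compose[unfolded o_def] id_def linear_id[unfolded id_def]
        o_def)
  have it: "linear (int_iterate T n) \<and> (\<forall>x. norm (int_iterate T n x) = norm x)" for n
    unfolding int_iterate_def
    using pow[of T] pow[of "inv T"] iso iso' linear_of_clinear[OF T(1)]
      linear_of_clinear[OF clinear_inv[OF T]] by simp
  have "bounded_linear (int_iterate T n)" for n
    using it[of n] by (intro bounded_linear.intro bounded_linear_axioms.intro exI[of _ 1]) auto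
  moreover have "bdd_above (range (\<lambda>n. onorm (int_iterate T n)))"
    using it by (intro bdd_aboveI2[of _ _ 1] onorm_bound) auto
  ultimately show ?thesis using T(2) by (simp add: doubly_power_bounded_def)
qed


section \<open>Recurrence of bounded orbits\<close>

text \<open>This is \<open>tr (r u r) = tr (b u)\<close>, where \<open>r\<close> is the square root of \<open>b\<close>.\<close>

definition weight :: "'a::complex_hilbert_space set \<Rightarrow> 'a bop \<Rightarrow> 'a bop \<Rightarrow> real"
  where "weight E r u = (\<Sum>\<^sub>\<infinity>e\<in>E. app u (app r e) \<bullet> app r e)"

lemma weight_add:
  assumes "orthonormal_basis E" "adj r = r" "hs_on E r"
  shows "weight E r (u + v) = weight E r u + weight E r v"
  unfolding weight_def using trace_square_mult(2)[OF assms]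
  by (simp add: inner_add_left infsum_add)

lemma weight_scaleR: "weight E r (c *\<^sub>R u) = c * weight E r u"
  unfolding weight_def by (simp add: infsum_cmult_right')

lemma weight_nonneg: "0 \<le> u \<Longrightarrow> 0 \<le> weight E r u"
  unfolding weight_def by (intro infsum_nonneg) (simp add: nonneg_bop_iff)

text \<open>Cauchy-Schwarz bounds each coefficient \<open>cinner x (app (adj a) e)\<close> of
  \<open>app a x\<close>, and Parseval sums the bounds.\<close>

lemma norm_app_le_hs:
  assumes E: "orthonormal_basis E" and a: "hs_on E a"
  shows "(norm (app a x))\<^sup>2 \<le> (\<Sum>\<^sub>\<infinity>e\<in>E. (norm (app a e))\<^sup>2) * (norm x)\<^sup>2"
proof -
  have on: "orthonormal E" using E by (simp add: orthonormal_basis_def)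
  have "(norm (app a x))\<^sup>2 \<le> (\<Sum>\<^sub>\<infinity>e\<in>E. (norm (app (adj a) e))\<^sup>2) * (norm x)\<^sup>2"
  proof (rule has_sum_mono[OF parseval[OF E]])
    show "((\<lambda>e. (norm (app (adj a) e))\<^sup>2 * (norm x)\<^sup>2) has_sum
      (\<Sum>\<^sub>\<infinity>e\<in>E. (norm (app (adj a) e))\<^sup>2) * (norm x)\<^sup>2) E"
      using hs_on_adj(1)[OF E on a] unfolding hs_on_def by (intro has_sum_cmult_left has_sum_infsum)
    show "(cmod (cinner (app a x) e))\<^sup>2 \<le> (norm (app (adj a) e))\<^sup>2 * (norm x)\<^sup>2" for e
      using power_mono[OF norm_cinner_le norm_ge_zero, of x "app (adj a) e" 2]
      by (simp add: cinner_app_left power_mult_distrib mult.commute)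
  qed
  then show ?thesis by (simp only: infsum_hs_adj[OF E a])
qed

text \<open>With \<open>q\<close> the square root of \<open>u\<close>, the weight is the squared
  Hilbert-Schmidt norm of \<open>q * r\<close>, which dominates the squared operator norm. This is
  how a small weight yields information about the order.\<close>

lemma form_le_weight:
  assumes E: "orthonormal_basis E" "hs_on E r" and u: "0 \<le> u"
  shows "app u (app r x) \<bullet> app r x \<le> weight E r u * (norm x)\<^sup>2"
proof -
  obtain q where q: "0 \<le> q" "q * q = u" using ex_sqrt_bop[OF u] by blast
  have "(norm (app (q * r) y))\<^sup>2 = app u (app r y) \<bullet> app r y" for y
    by (simp add: q(2)[symmetric] power2_norm_eq_inner inner_app_left[of q "app q _"] adj_nonneg[OF q(1)])
  then show ?thesis
    using norm_app_le_hs[OF E(1) hs_on_mult_left[OF E(2)], of q x] by (simp only: weight_def)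
qed

lemma csubspace_range_app: "csubspace (range (app a))"
  unfolding csubspace_def
proof (intro conjI ballI allI)
  show "0 \<in> range (app a)" by (rule range_eqI[of _ _ 0]) simp
  show "x + y \<in> range (app a)" if "x \<in> range (app a)" "y \<in> range (app a)" for x y
    using that by (auto simp flip: app_add)
  show "c *\<^sub>C x \<in> range (app a)" if "x \<in> range (app a)" for c x
    using that by (auto simp flip: app_scaleC)
qed

text \<open>A self-adjoint injective \<open>r\<close> has dense range, and the form of a bounded
  operator is continuous.\<close>

lemma nonneg_on_range:
  assumes r: "adj r = r" "\<And>y. app r y = 0 \<Longrightarrow> y = 0"
    and form: "\<And>x. 0 \<le> app z (app r x) \<bullet> app r x"
  shows "0 \<le> app z x \<bullet> x"
proof -
  have "\<exists>m\<in>range (app r). norm (x - m) < 1 / Suc n" for n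
  proof (rule csubspace_dense[OF csubspace_range_app])
    fix y assume "\<And>m. m \<in> range (app r) \<Longrightarrow> cinner m y = 0"
    then have "cinner (app r (app r y)) y = 0" by blast
    then have "cinner (app r y) (app r y) = 0" by (simp add: cinner_app_left[of r "app r y"] r(1))
    then show "y = 0" by (simp add: cinner_self r(2))
  qed simp
  then obtain m where m: "m n \<in> range (app r)" "norm (x - m n) < 1 / Suc n" for n by metis
  have "m \<longlonglongrightarrow> x"
  proof (rule LIM_zero_cancel, rule LIMSEQ_norm_0)
    show "norm (m n - x) < 1 / Suc n" for n using m(2)[of n] by (simp add: norm_minus_commute)
  qed
  then have "(\<lambda>n. app z (m n) \<bullet> m n) \<longlonglongrightarrow> app z x \<bullet> x"
    by (intro tendsto_inner tendsto_app)
  moreover have "0 \<le> app z (m n) \<bullet> m n" for n using m(1)[of n] form by auto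
  ultimately show ?thesis by (intro LIMSEQ_le_const) auto
qed

section \<open>Rank-one operators and complements of finite orthonormal sets\<close>

definition rank_one :: "'a::complex_hilbert_space \<Rightarrow> 'a bop"
  where "rank_one f = Bop (\<lambda>x. cinner x f *\<^sub>C f)"

lemma app_rank_one [simp]: "app (rank_one f) x = cinner x f *\<^sub>C f"
proof -
  have "bounded_linear (\<lambda>x. cinner x f *\<^sub>C f)"
  proof (rule bounded_linear_intro)
    fix x y :: 'a and c :: real
    show "cinner (x + y) f *\<^sub>C f = cinner x f *\<^sub>C f + cinner y f *\<^sub>C f"
      by (simp add: cinner_add_left scaleC_add_left)
    show "cinner (c *\<^sub>R x) f *\<^sub>C f = c *\<^sub>R cinner x f *\<^sub>C f"
      by (simp add: scaleR_scaleC cinner_scaleC_left scaleC_scaleC)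
    show "norm (cinner x f *\<^sub>C f) \<le> norm x * (norm f * norm f)"
      using mult_right_mono[OF norm_cinner_le norm_ge_zero, of x f f]
      by (simp add: norm_scaleC mult.assoc)
  qed
  then show ?thesis
    unfolding rank_one_def
    by (subst Bop_inverse)
       (simp_all add: clinear_iff cinner_add_left scaleC_add_left cinner_scaleC_left scaleC_scaleC)
qed

lemma adj_rank_one: "adj (rank_one f) = rank_one f"
  by (rule adj_eqI) (simp add: cinner_scaleC_left cinner_scaleC_right cinner_commute[of f])

lemma rank_one_nonneg: "0 \<le> rank_one f"
proof -
  have "app (rank_one f) x \<bullet> x = (cmod (cinner x f))\<^sup>2" for x
  proof -
    have "cinner (app (rank_one f) x) x = of_real ((cmod (cinner x f))\<^sup>2)"
      unfolding complex_norm_square by (simp add: cinner_scaleC_left cinner_commute[of f])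
    then show ?thesis by (simp only: Re_cinner[symmetric] Re_complex_of_real)
  qed
  then show ?thesis by (simp add: nonneg_bop_iff adj_rank_one)
qed

text \<open>For orthonormal \<open>F\<close>, this is the orthogonal projection onto the complement
  of the span of \<open>F\<close>.\<close>

definition coprojection :: "'a::complex_hilbert_space set \<Rightarrow> 'a bop"
  where "coprojection F = 1 - (\<Sum>f\<in>F. rank_one f)"

lemma app_coprojection: "app (coprojection F) x = x - (\<Sum>f\<in>F. cinner x f *\<^sub>C f)"
  by (simp add: coprojection_def app_sum_bop)

lemma adj_coprojection: "adj (coprojection F) = coprojection F"
  by (simp add: coprojection_def adj_diff adj_sum adj_rank_one)

lemma coprojection_basis:
  assumes "orthonormal E" "finite F" "F \<subseteq> E" "e \<in> E"
  shows "app (coprojection F) e = (if e \<in> F then 0 else e)"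
proof -
  have "cinner e f = (if f = e then 1 else 0)" if "f \<in> F" for f
    using assms that unfolding orthonormal_def by (metis subsetD)
  then have "(\<Sum>f\<in>F. cinner e f *\<^sub>C f) = (\<Sum>f\<in>F. if f = e then e else 0)"
    by (intro sum.cong) auto
  then show ?thesis using assms(2) by (simp add: app_coprojection)
qed

lemma coprojection_idem:
  assumes "orthonormal E" "finite F" "F \<subseteq> E"
  shows "coprojection F * coprojection F = coprojection F"
proof (rule bop_eqI)
  fix x
  have "(\<Sum>f\<in>F. cinner (app (coprojection F) x) f *\<^sub>C f) = 0"
  proof (rule sum.neutral, rule ballI)
    fix f assume "f \<in> F"
    then have "cinner (app (coprojection F) x) f = cinner x (app (coprojection F) f)"
      by (simp add: cinner_app_left adj_coprojection)
    then show "cinner (app (coprojection F) x) f *\<^sub>C f = 0"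
      using coprojection_basis[OF assms, of f] \<open>f \<in> F\<close> assms(3) by auto
  qed
  then show "app (coprojection F * coprojection F) x = app (coprojection F) x"
    by (simp add: app_coprojection[of F "app (coprojection F) x"])
qed

lemma form_coprojection:
  assumes "orthonormal E" "finite F" "F \<subseteq> E"
  shows "app (coprojection F) x \<bullet> x = (norm (app (coprojection F) x))\<^sup>2"
proof -
  have "app (coprojection F) x \<bullet> app (coprojection F) x = x \<bullet> app (coprojection F * coprojection F) x"
    by (simp add: inner_app_left[of "coprojection F" x] adj_coprojection)
  then show ?thesis
    by (simp only: coprojection_idem[OF assms] power2_norm_eq_inner inner_commute)
qed

text \<open>The weight of a projection \<open>q\<close> is the squared Hilbert-Schmidt norm of
  \<open>q * r\<close>, hence of its adjoint \<open>r * q\<close>. As \<open>q\<close> kills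
  \<open>F\<close> and fixes the rest of \<open>E\<close>, this is a tail of the convergent series
  for \<open>r\<close>.\<close>

lemma weight_coprojection_small:
  assumes E: "orthonormal_basis E" and r: "adj r = r" "hs_on E r" and \<epsilon>: "0 < \<epsilon>"
  shows "\<exists>F. finite F \<and> F \<subseteq> E \<and> weight E r (coprojection F) \<le> \<epsilon>"
proof -
  have on: "orthonormal E" using E by (simp add: orthonormal_basis_def)
  let ?f = "\<lambda>e. (norm (app r e))\<^sup>2"
  have f: "?f summable_on E" using r(2) by (simp add: hs_on_def)
  obtain F where F: "finite F" "F \<subseteq> E" "dist (sum ?f F) (infsum ?f E) \<le> \<epsilon>"
    using infsum_finite_approximation[OF f \<epsilon>] by blast
  let ?q = "coprojection F"
  have "weight E r ?q = (\<Sum>\<^sub>\<infinity>e\<in>E. (norm (app (?q * r) e))\<^sup>2)"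
    by (simp add: weight_def form_coprojection[OF on F(1,2)])
  also have "\<dots> = (\<Sum>\<^sub>\<infinity>e\<in>E. (norm (app (r * ?q) e))\<^sup>2)"
    using infsum_hs_adj[OF E hs_on_mult_left[OF r(2)], of ?q] by (simp add: adj_mult adj_coprojection r(1))
  also have "\<dots> = (\<Sum>\<^sub>\<infinity>e\<in>E - F. ?f e)"
    by (rule infsum_cong_neutral) (auto simp: coprojection_basis[OF on F(1,2)])
  also have "\<dots> = infsum ?f E - sum ?f F"
    using infsum_Diff[OF f summable_on_finite[OF F(1)] F(2)] F(1) by simp
  finally show ?thesis using F by (auto simp: dist_real_def intro!: exI[of _ F])
qed

text \<open>The vector splits as \<open>a + d\<close> with \<open>a\<close> in the span of
  \<open>F\<close> and \<open>d\<close> orthogonal to it. The entries control the block of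
  \<open>a\<close>, the norm bound that of \<open>d\<close>, and the mixed terms are divided by the
  arithmetic-geometric mean inequality: \<open>\<kappa>\<close> keeps their share on
  \<open>(norm \<xi>)\<^sup>2\<close> small at the price of \<open>1 / \<kappa>\<close> on the
  complement.\<close>

lemma form_le_coprojection:
  assumes on: "orthonormal E" "finite F" "F \<subseteq> E"
    and y: "adj y = y" "norm y \<le> C"
    and entries: "\<And>f g. f \<in> F \<Longrightarrow> g \<in> F \<Longrightarrow> cmod (cinner (app y f) g) \<le> \<delta>"
    and \<kappa>: "0 < \<kappa>"
  shows "\<bar>app y \<xi> \<bullet> \<xi>\<bar> \<le> (\<delta> * card F + C * \<kappa>) * (norm \<xi>)\<^sup>2
    + C * (1 / \<kappa> + 1) * (norm (app (coprojection F) \<xi>))\<^sup>2"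
\<comment> \<open>For empty \<open>F\<close> no entry shows that \<open>\<delta>\<close> is
  nonnegative, but then \<open>coprojection F\<close> is the identity and the norm bound is
  enough.\<close>
proof (cases "F = {}")
  case True
  have C: "0 \<le> C" using y(2) norm_ge_zero order_trans by blast
  have "\<bar>app y \<xi> \<bullet> \<xi>\<bar> \<le> C * norm \<xi> * norm \<xi>"
    using order_trans[OF Cauchy_Schwarz_ineq2 mult_right_mono[OF order_trans[OF norm_app_le
        mult_right_mono[OF y(2) norm_ge_zero]] norm_ge_zero]] .
  also have "\<dots> \<le> (\<delta> * card F + C * \<kappa>) * (norm \<xi>)\<^sup>2
    + C * (1 / \<kappa> + 1) * (norm (app (coprojection F) \<xi>))\<^sup>2"
    using True C \<kappa> by (simp add: app_coprojection power2_eq_square algebra_simps)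
  finally show ?thesis .
next
  case False
  let ?q = "coprojection F"
  define a where "a = (\<Sum>f\<in>F. cinner \<xi> f *\<^sub>C f)"
  define d where "d = app ?q \<xi>"
  have C: "0 \<le> C" using y(2) norm_ge_zero order_trans by blast
  have \<xi>: "\<xi> = a + d" by (simp add: a_def d_def app_coprojection)
  have na: "norm a \<le> norm \<xi>"
  proof -
    have "a \<bullet> d = 0"
    proof -
      have "app ?q d = d"
        using arg_cong[OF coprojection_idem[OF on], of "\<lambda>z. app z \<xi>"] by (simp add: d_def)
      moreover have "app ?q (a + d) = d" unfolding \<xi>[symmetric] by (simp only: d_def)
      ultimately have "app ?q a = 0" by simp
      then have "app ?q \<xi> \<bullet> a = 0" by (simp add: inner_app_left adj_coprojection)
      then show ?thesis by (simp only: d_def inner_commute)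
    qed
    then have "(norm \<xi>)\<^sup>2 = (norm a)\<^sup>2 + (norm d)\<^sup>2"
      by (simp add: \<xi> power2_norm_eq_inner inner_add_left inner_add_right inner_commute)
    then show ?thesis by (simp add: power2_le_imp_le)
  qed
  have bound: "\<bar>app y v \<bullet> w\<bar> \<le> C * (norm v * norm w)" for v w
    using order_trans[OF Cauchy_Schwarz_ineq2 mult_right_mono[OF order_trans[OF norm_app_le
        mult_right_mono[OF y(2) norm_ge_zero]] norm_ge_zero]] by (simp add: mult.assoc)
  have "\<bar>app y a \<bullet> a\<bar> \<le> \<delta> * card F * (norm \<xi>)\<^sup>2"
  proof -
    let ?c = "\<lambda>f. cmod (cinner \<xi> f)"
    have "cinner (app y a) a = (\<Sum>f\<in>F. \<Sum>g\<in>F. cinner \<xi> f * cnj (cinner \<xi> g) * cinner (app y f) g)"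
      by (simp add: a_def app_sum cinner_sum_left cinner_sum_right cinner_scaleC_left
          cinner_scaleC_right mult_ac sum_distrib_left) (rule sum.swap)
    then have "cmod (cinner (app y a) a) \<le> (\<Sum>f\<in>F. \<Sum>g\<in>F. ?c f * ?c g * \<delta>)"
      using entries
      by (auto intro!: order_trans[OF norm_sum] sum_mono simp: norm_mult mult_left_mono)
    also have "\<dots> = \<delta> * (\<Sum>f\<in>F. ?c f)\<^sup>2"
      by (simp add: power2_eq_square sum_product sum_distrib_left mult_ac)
    \<comment> \<open>Cauchy-Schwarz over \<open>F\<close> gives the factor \<open>card F\<close>,
      and Bessel bounds the sum of squares.\<close>
    also have "\<dots> \<le> \<delta> * (card F * (norm \<xi>)\<^sup>2)"
    proof (rule mult_left_mono)
      have "(\<Sum>f\<in>F. ?c f)\<^sup>2 \<le> card F * (\<Sum>f\<in>F. (?c f)\<^sup>2)"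
        using sum_squared_le_sum_of_squares[of ?c F] on(2) by (simp add: mult.commute)
      also have "\<dots> \<le> card F * (norm \<xi>)\<^sup>2" by (intro mult_left_mono bessel[OF on]) simp
      finally show "(\<Sum>f\<in>F. ?c f)\<^sup>2 \<le> card F * (norm \<xi>)\<^sup>2" .
      show "0 \<le> \<delta>" using False entries norm_ge_zero order_trans by blast
    qed
    finally show ?thesis
      using abs_Re_le_cmod[of "cinner (app y a) a"] by (simp add: Re_cinner mult.assoc)
  qed
  moreover have "\<bar>2 * (app y a \<bullet> d)\<bar> \<le> C * \<kappa> * (norm \<xi>)\<^sup>2 + C * (1 / \<kappa>) * (norm d)\<^sup>2"
  proof -
    have "\<bar>2 * (app y a \<bullet> d)\<bar> \<le> C * (2 * (norm \<xi> * norm d))"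
      using bound[of a d] mult_left_mono[OF mult_right_mono[OF na norm_ge_zero[of d]] C] by simp
    also have "2 * (norm \<xi> * norm d) \<le> \<kappa> * (norm \<xi>)\<^sup>2 + 1 / \<kappa> * (norm d)\<^sup>2"
      using sum_squares_bound[of "\<kappa> * norm \<xi>" "norm d"] \<kappa>
      by (simp add: field_simps power2_eq_square)
    finally show ?thesis using C by (simp add: distrib_left mult.assoc mult_left_mono)
  qed
  moreover have "\<bar>app y d \<bullet> d\<bar> \<le> C * (norm d)\<^sup>2"
    using bound[of d d] by (simp add: power2_eq_square)
  moreover have "app y \<xi> \<bullet> \<xi> = app y a \<bullet> a + 2 * (app y a \<bullet> d) + app y d \<bullet> d"
    using inner_app_left[of y d a] y(1)
    by (simp add: \<xi> inner_add_left inner_add_right inner_commute)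
  ultimately show ?thesis by (simp add: d_def distrib_right distrib_left)
qed

text \<open>The dominating \<open>u\<close> is a small multiple of the identity plus a possibly
  large multiple of \<open>coprojection F\<close>. The parameters are fixed in the order
  \<open>\<kappa>\<close>, \<open>F\<close>, \<open>\<delta>\<close>: \<open>\<kappa>\<close>
  determines the factor \<open>K\<close> of the coprojection, \<open>F\<close> must make its weight
  small against \<open>1 / K\<close>, and \<open>\<delta>\<close> must compensate for
  \<open>card F\<close>. Each of the three costs at most \<open>\<epsilon> / 3\<close>.\<close>

lemma weight_domination:
  assumes E: "orthonormal_basis E" and r: "adj r = r" "hs_on E r"
    and C: "0 \<le> C" and \<epsilon>: "0 < \<epsilon>"
  shows "\<exists>F \<delta>. finite F \<and> F \<subseteq> E \<and> 0 < \<delta> \<and>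
    (\<forall>y. adj y = y \<longrightarrow> norm y \<le> C \<longrightarrow> (\<forall>f\<in>F. \<forall>g\<in>F. cmod (cinner (app y f) g) \<le> \<delta>) \<longrightarrow>
      (\<exists>u. - u \<le> y \<and> y \<le> u \<and> weight E r u \<le> \<epsilon>))"
proof -
  have on: "orthonormal E" using E by (simp add: orthonormal_basis_def)
  define W where "W = weight E r 1"
  have W: "0 \<le> W" by (simp add: W_def weight_nonneg one_bop_nonneg)
  \<comment> \<open>The added 1 in the denominator allows \<open>k = 0\<close> in all three
    choices.\<close>
  have small: "k * (\<epsilon> / (3 * (k + 1))) \<le> \<epsilon> / 3" if "0 \<le> k" for k :: real
    using that \<epsilon> by (simp add: divide_simps)
  define \<kappa> where "\<kappa> = \<epsilon> / (3 * (C * W + 1))"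
  have \<kappa>: "0 < \<kappa>" using C W \<epsilon> by (simp add: \<kappa>_def add_nonneg_pos)
  define K where "K = C * (1 / \<kappa> + 1)"
  have K: "0 \<le> K" using C \<kappa> by (simp add: K_def)
  obtain F where F: "finite F" "F \<subseteq> E" "weight E r (coprojection F) \<le> \<epsilon> / (3 * (K + 1))"
    using weight_coprojection_small[OF E r, of "\<epsilon> / (3 * (K + 1))"] K \<epsilon> by auto
  define \<delta> where "\<delta> = \<epsilon> / (3 * (card F * W + 1))"
  have \<delta>: "0 < \<delta>" using W \<epsilon> by (simp add: \<delta>_def add_nonneg_pos)
  define u where "u = (\<delta> * card F + C * \<kappa>) *\<^sub>R 1 + K *\<^sub>R coprojection F"
  have "weight E r u = (card F * W) * \<delta> + (C * W) * \<kappa> + K * weight E r (coprojection F)"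
    by (simp add: u_def weight_add[OF E r] weight_scaleR W_def algebra_simps)
  also have "\<dots> \<le> \<epsilon> / 3 + \<epsilon> / 3 + \<epsilon> / 3"
  proof (intro add_mono)
    show "(card F * W) * \<delta> \<le> \<epsilon> / 3" unfolding \<delta>_def using W by (intro small) simp
    show "(C * W) * \<kappa> \<le> \<epsilon> / 3" unfolding \<kappa>_def using C W by (intro small) simp
    show "K * weight E r (coprojection F) \<le> \<epsilon> / 3"
      by (rule order_trans[OF mult_left_mono[OF F(3) K] small[OF K]])
  qed
  finally have wu: "weight E r u \<le> \<epsilon>" by simp
  have "- u \<le> y \<and> y \<le> u"
    if y: "adj y = y" "norm y \<le> C" "\<forall>f\<in>F. \<forall>g\<in>F. cmod (cinner (app y f) g) \<le> \<delta>" for y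
  proof -
    have adju: "adj u = u" by (simp add: u_def adj_add adj_scaleR adj_coprojection)
    have "\<bar>app y \<xi> \<bullet> \<xi>\<bar> \<le> app u \<xi> \<bullet> \<xi>" for \<xi>
    proof -
      have "app u \<xi> \<bullet> \<xi> = (\<delta> * card F + C * \<kappa>) * (norm \<xi>)\<^sup>2 + K * (norm (app (coprojection F) \<xi>))\<^sup>2"
        by (simp add: u_def inner_add_left form_coprojection[OF on F(1,2)] power2_norm_eq_inner[of \<xi>]
            algebra_simps)
      then show ?thesis
        using form_le_coprojection[OF on F(1,2) y(1,2) _ \<kappa>, of \<delta> \<xi>] y(3) by (simp add: K_def)
    qed
    then have "app y \<xi> \<bullet> \<xi> \<le> app u \<xi> \<bullet> \<xi>" "- (app u \<xi> \<bullet> \<xi>) \<le> app y \<xi> \<bullet> \<xi>" for \<xi>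
      by (smt (verit))+
    then show ?thesis by (simp add: less_eq_bop_iff adj_diff adj_add adju y(1))
  qed
  then show ?thesis using F(1,2) \<delta> wu by blast
qed

section \<open>Close terms in bounded sequences\<close>

lemma ex_common_convergent_subsequence:
  fixes c :: "nat \<Rightarrow> 'i \<Rightarrow> complex"
  assumes "finite I" "\<And>n k. k \<in> I \<Longrightarrow> cmod (c n k) \<le> C"
  shows "\<exists>s. strict_mono s \<and> (\<forall>k\<in>I. convergent (\<lambda>n. c (s n) k))"
  using assms
proof (induction I)
  case empty
  show ?case by (rule exI[of _ id]) (simp add: strict_mono_def)
next
  case (insert k I)
  then obtain s where s: "strict_mono s" "\<forall>k\<in>I. convergent (\<lambda>n. c (s n) k)" by auto
  have "bounded (range (\<lambda>n. c (s n) k))"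
    using insert.prems by (auto simp: bounded_iff)
  then obtain l t where t: "strict_mono t" "((\<lambda>n. c (s n) k) \<circ> t) \<longlonglongrightarrow> l"
    using bounded_imp_convergent_subsequence by blast
  have "convergent (\<lambda>n. c (s (t n)) i)" if "i \<in> I" for i
    using convergent_subseq_convergent[OF _ t(1), of "\<lambda>n. c (s n) i"] s(2) that by (simp add: o_def)
  moreover have "convergent (\<lambda>n. c (s (t n)) k)"
    using t(2) by (auto simp: convergent_def o_def)
  ultimately show ?case
    using strict_mono_o[OF s(1) t(1)] by (intro exI[of _ "s \<circ> t"]) (auto simp: o_def)
qed

text \<open>Late consecutive terms of a common convergent subsequence are close, and the selection
  is strictly increasing, whence \<open>i < j\<close>.\<close>

lemma ex_close_terms:
  fixes c :: "nat \<Rightarrow> 'i \<Rightarrow> complex"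
  assumes I: "finite I" and c: "\<And>n k. k \<in> I \<Longrightarrow> cmod (c n k) \<le> C" and \<delta>: "0 < \<delta>"
  shows "\<exists>i j. i < j \<and> (\<forall>k\<in>I. cmod (c i k - c j k) \<le> \<delta>)"
proof -
  obtain s where s: "strict_mono s" "\<forall>k\<in>I. convergent (\<lambda>n. c (s n) k)"
    using ex_common_convergent_subsequence[of I c C] I c by blast
  have "\<forall>k\<in>I. \<forall>\<^sub>F n in sequentially. cmod (c (s n) k - c (s (Suc n)) k) < \<delta>"
  proof
    fix k assume "k \<in> I"
    then have "Cauchy (\<lambda>n. c (s n) k)" using s(2) by (blast intro: convergent_Cauchy)
    then obtain N where N: "\<And>m n. m \<ge> N \<Longrightarrow> n \<ge> N \<Longrightarrow> norm (c (s m) k - c (s n) k) < \<delta>"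
      using CauchyD[OF _ \<delta>] by blast
    then show "\<forall>\<^sub>F n in sequentially. cmod (c (s n) k - c (s (Suc n)) k) < \<delta>"
      by (intro eventually_sequentiallyI[of N]) auto
  qed
  then have "\<forall>\<^sub>F n in sequentially. \<forall>k\<in>I. cmod (c (s n) k - c (s (Suc n)) k) < \<delta>"
    by (intro eventually_ball_finite I)
  then obtain n where "\<forall>k\<in>I. cmod (c (s n) k - c (s (Suc n)) k) < \<delta>"
    by (auto simp: eventually_sequentially)
  moreover have "s n < s (Suc n)" using s(1) by (simp add: strict_mono_def)
  ultimately show ?thesis by (intro exI[of _ "s n"] exI[of _ "s (Suc n)"]) (auto simp: less_imp_le)
qed

text \<open>
  Norm-bounded sets of self-adjoint operators are precompact for the seminorm
  \<open>inf {weight E r u. - u \<le> y \<le> u}\<close>, hence any bounded sequence has close terms.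
\<close>

lemma bounded_sequence_recurrence:
  fixes x :: "nat \<Rightarrow> 'a::complex_hilbert_space bop"
  assumes E: "orthonormal_basis E" and r: "adj r = r" "hs_on E r"
    and x: "\<And>n. adj (x n) = x n" "\<And>n. norm (x n) \<le> C" and \<epsilon>: "0 < \<epsilon>"
  shows "\<exists>i j u. i < j \<and> - u \<le> x i - x j \<and> x i - x j \<le> u \<and> weight E r u \<le> \<epsilon>"
proof -
  have C: "0 \<le> C" using x(2) norm_ge_zero order_trans by blast
  obtain F \<delta> where F: "finite F" "F \<subseteq> E" "0 < \<delta>"
    and dom: "\<And>y. adj y = y \<Longrightarrow> norm y \<le> 2 * C \<Longrightarrow>
      (\<forall>f\<in>F. \<forall>g\<in>F. cmod (cinner (app y f) g) \<le> \<delta>) \<Longrightarrow>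
      \<exists>u. - u \<le> y \<and> y \<le> u \<and> weight E r u \<le> \<epsilon>"
    using weight_domination[OF E r, of "2 * C" \<epsilon>] C \<epsilon> by auto
  have norm_F: "norm f = 1" if "f \<in> F" for f
  proof -
    have "orthonormal E" "f \<in> E" using E F(2) that by (auto simp: orthonormal_basis_def)
    then have "cinner f f = 1" by (simp add: orthonormal_def)
    then have "(norm f)\<^sup>2 = 1" by (simp only: cinner_self of_real_eq_1_iff)
    then show ?thesis using norm_ge_zero[of f] by (auto simp: power2_eq_1_iff)
  qed
  have "cmod (cinner (app (x n) (fst k)) (snd k)) \<le> C" if "k \<in> F \<times> F" for n k
  proof -
    have "cmod (cinner (app (x n) (fst k)) (snd k)) \<le> norm (x n) * norm (fst k) * norm (snd k)"
      by (rule order_trans[OF norm_cinner_le mult_right_mono[OF norm_app_le norm_ge_zero]])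
    then show ?thesis using that norm_F x(2)[of n] by (auto simp: mem_Times_iff)
  qed
  then obtain i j where ij: "i < j"
    "\<forall>k\<in>F\<times>F. cmod (cinner (app (x i) (fst k)) (snd k) - cinner (app (x j) (fst k)) (snd k)) \<le> \<delta>"
    using ex_close_terms[of "F \<times> F" "\<lambda>n k. cinner (app (x n) (fst k)) (snd k)" C \<delta>] F(1,3)
    by auto
  have "\<exists>u. - u \<le> x i - x j \<and> x i - x j \<le> u \<and> weight E r u \<le> \<epsilon>"
  proof (rule dom)
    show "adj (x i - x j) = x i - x j" by (simp add: adj_diff x(1))
    show "norm (x i - x j) \<le> 2 * C"
      using norm_triangle_ineq4[of "x i" "x j"] x(2)[of i] x(2)[of j] by simp
    show "\<forall>f\<in>F. \<forall>g\<in>F. cmod (cinner (app (x i - x j) f) g) \<le> \<delta>"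
      using ij(2) by (auto simp: cinner_diff_left)
  qed
  then show ?thesis using ij(1) by blast
qed

section \<open>Positivity of the inverse\<close>

lemma nonneg_of_minus_le:
  assumes "- u \<le> (u :: 'a::complex_hilbert_space bop)"
  shows "0 \<le> u"
proof -
  have "0 \<le> (1/2) *\<^sub>R (u + u)"
    using add_right_mono[OF assms, of u] by (intro nonneg_scaleR_bop) simp_all
  then show ?thesis by (simp only: scaleR_half_double)
qed

lemma funpow_inv_cancel:
  assumes "bij T"
  shows "(T ^^ k) ((inv T ^^ (k + m)) x) = (inv T ^^ m) x"
proof (induction k)
  case (Suc k)
  have "(T ^^ Suc k) y = (T ^^ k) (T y)" for y
    by (simp only: funpow_Suc_right o_apply)
  moreover have "(inv T ^^ (Suc k + m)) x = inv T ((inv T ^^ (k + m)) x)"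
    by (simp only: add_Suc funpow.simps o_apply)
  ultimately show ?case
    using Suc assms by (simp only: bij_is_surj surj_f_inv_f)
qed simp

text \<open>Recurrence yields \<open>- u \<le> inv T x\<close> with \<open>u\<close> of arbitrarily
  small weight. On the range of \<open>r\<close> a small weight means a small form, and that range
  is dense.\<close>

lemma inv_positive_of_power_bounded:
  fixes T :: "'a::complex_hilbert_space bop \<Rightarrow> 'a bop"
  assumes E: "orthonormal_basis E" and r: "adj r = r" "hs_on E r" "\<And>y. app r y = 0 \<Longrightarrow> y = 0"
    and T: "clinear T" "positive_map T" "bij T"
    and weight: "\<And>u. 0 \<le> u \<Longrightarrow> weight E r (T u) \<le> weight E r u"
    and bounded: "\<And>n x. norm ((inv T ^^ n) x) \<le> C * norm x"
  shows "positive_map (inv T)"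
  unfolding positive_map_def
proof (intro allI impI)
  fix x :: "'a bop"
  assume x: "0 \<le> x"
  have T_inv: "T (inv T y) = y" for y using T(3) by (simp add: bij_is_surj surj_f_inv_f)
  have herm: "adj (inv T y) = inv T y" if "adj y = y" for y
  proof -
    have "T (adj (inv T y)) = T (inv T y)" by (simp add: positive_map_adj[OF T(1,2)] T_inv that)
    then show ?thesis using T(3) by (simp add: bij_is_inj inj_eq)
  qed
  have herm_pow: "adj ((inv T ^^ n) x) = (inv T ^^ n) x" for n
    by (induction n) (simp_all add: adj_nonneg[OF x] herm)
  have pos_pow: "0 \<le> (T ^^ n) x" for n
    using x T(2) by (induction n) (simp_all add: positive_map_def)
  have lin: "clinear (T ^^ n)" for n
    using T(1) by (induction n) (simp_all add: clinear_iff)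
  \<comment> \<open>Positivity carries the order interval from \<open>u\<close> to
    \<open>T u\<close>, and \<open>weight\<close> keeps the bound; its premise
    \<open>0 \<le> u\<close> follows from \<open>- u \<le> u\<close>.\<close>
  have dominated: "\<exists>u. - u \<le> (T ^^ n) y \<and> (T ^^ n) y \<le> u \<and> weight E r u \<le> \<epsilon>"
    if "- u \<le> y" "y \<le> u" "weight E r u \<le> \<epsilon>" for u y \<epsilon> n
  proof (induction n)
    case 0
    show ?case using that by auto
  next
    case (Suc n)
    then obtain u where u: "- u \<le> (T ^^ n) y" "(T ^^ n) y \<le> u" "weight E r u \<le> \<epsilon>" by blast
    have "0 \<le> u" using order_trans[OF u(1,2)] by (rule nonneg_of_minus_le)
    have "T (- u) = - T u" using clinear_diff[OF T(1), of 0 u] clinear_diff[OF T(1), of 0 0] by simp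
    then have "- T u \<le> (T ^^ Suc n) y" "(T ^^ Suc n) y \<le> T u"
      using positive_map_mono[OF T(1,2) u(1)] positive_map_mono[OF T(1,2) u(2)] by simp_all
    moreover have "weight E r (T u) \<le> \<epsilon>" using weight[OF \<open>0 \<le> u\<close>] u(3) by simp
    ultimately show ?case by blast
  qed
  have approx: "\<exists>u. 0 \<le> inv T x + u \<and> 0 \<le> u \<and> weight E r u \<le> \<epsilon>" if \<epsilon>: "0 < \<epsilon>" for \<epsilon>
  proof -
    obtain i j u where ij: "i < j" and u: "- u \<le> (inv T ^^ i) x - (inv T ^^ j) x"
      "(inv T ^^ i) x - (inv T ^^ j) x \<le> u" "weight E r u \<le> \<epsilon>"
      using bounded_sequence_recurrence[OF E r(1,2), of "\<lambda>n. (inv T ^^ n) x" "C * norm x" \<epsilon>]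
        herm_pow bounded \<epsilon> by blast
    \<comment> \<open>The power applied is \<open>i + k = j - 1\<close>. It leaves a single inverse
      on the later term and turns the earlier one into \<open>(T ^^ k) x\<close>, possibly with
      \<open>k = 0\<close>.\<close>
    define k where "k = j - Suc i"
    have j: "j = (i + k) + 1" using ij by (simp add: k_def)
    have "(T ^^ (i + k)) ((inv T ^^ i) x) = (T ^^ k) ((T ^^ i) ((inv T ^^ (i + 0)) x))"
      by (simp add: funpow_add add.commute[of i])
    also have "\<dots> = (T ^^ k) x" unfolding funpow_inv_cancel[OF T(3)] by simp
    finally have Ti: "(T ^^ (i + k)) ((inv T ^^ i) x) = (T ^^ k) x" .
    have Tj: "(T ^^ (i + k)) ((inv T ^^ j) x) = inv T x"
      unfolding j funpow_inv_cancel[OF T(3)] by simp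
    obtain v where v: "- v \<le> (T ^^ k) x - inv T x" "(T ^^ k) x - inv T x \<le> v" "weight E r v \<le> \<epsilon>"
      using dominated[OF u, of "i + k"] by (auto simp: clinear_diff[OF lin] Ti Tj)
    have "0 \<le> (T ^^ k) x" by (rule pos_pow)
    also have "\<dots> \<le> inv T x + v" using v(2) by (simp add: diff_le_eq add.commute)
    finally have "0 \<le> inv T x + v" .
    moreover have "0 \<le> v" using order_trans[OF v(1,2)] by (rule nonneg_of_minus_le)
    ultimately show ?thesis using v(3) by blast
  qed
  have form: "0 \<le> app (inv T x) (app r \<xi>) \<bullet> app r \<xi>" for \<xi>
  proof (rule field_le_epsilon)
    fix e :: real assume e: "0 < e"
    \<comment> \<open>The bound on the weight gets multiplied by
      \<open>(norm \<xi>)\<^sup>2\<close>; the added 1 covers \<open>\<xi> = 0\<close>.\<close>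
    define \<epsilon> where "\<epsilon> = e / ((norm \<xi>)\<^sup>2 + 1)"
    have pos: "0 < (norm \<xi>)\<^sup>2 + 1" by (simp add: add_nonneg_pos)
    then obtain u where u: "0 \<le> inv T x + u" "0 \<le> u" "weight E r u \<le> \<epsilon>"
      using approx[of \<epsilon>] e by (auto simp: \<epsilon>_def)
    have "app u (app r \<xi>) \<bullet> app r \<xi> \<le> \<epsilon> * (norm \<xi>)\<^sup>2"
      by (rule order_trans[OF form_le_weight[OF E r(2) u(2)] mult_right_mono[OF u(3)]]) simp
    also have "\<dots> \<le> e"
      unfolding \<epsilon>_def using e pos by (simp add: field_simps)
    finally show "0 \<le> app (inv T x) (app r \<xi>) \<bullet> app r \<xi> + e"
      using u(1) unfolding nonneg_bop_iff
      by (simp add: inner_add_left) (smt (verit))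
  qed
  have "0 \<le> app (inv T x) \<xi> \<bullet> \<xi>" for \<xi>
    by (rule nonneg_on_range[OF r(1) _ form]) (rule r(3))
  then show "0 \<le> inv T x"
    by (simp add: nonneg_bop_iff herm adj_nonneg[OF x])
qed

text \<open>The diagonal series is Parseval's series for the inner product of
  \<open>app c \<xi>\<close> and \<open>\<xi>\<close>, absolutely convergent for every bounded
  \<open>c\<close>. It lets the trace pairing recover quadratic forms.\<close>

lemma tr_mult_rank_one:
  assumes E: "orthonormal_basis (some_onb :: 'a::complex_hilbert_space set)"
  shows "Re (tr (c * rank_one \<xi>)) = app c \<xi> \<bullet> (\<xi> :: 'a)"
proof -
  let ?f = "\<lambda>e. cinner (app (c * rank_one \<xi>) e) e"
  have f: "?f e = cinner (app c \<xi>) e * cnj (cinner \<xi> e)" for e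
    by (simp add: cinner_scaleC_left cinner_commute[of e \<xi>] mult.commute)
  have "?f summable_on some_onb"
  proof (rule Infinite_Sum.abs_summable_summable, rule Infinite_Sum.abs_summable_on_comparison_test')
    show "(\<lambda>e. (cmod (cinner (app c \<xi>) e))\<^sup>2 + (cmod (cinner \<xi> e))\<^sup>2) summable_on some_onb"
      by (intro summable_on_add has_sum_imp_summable[OF parseval[OF E]])
    show "cmod (?f e) \<le> (cmod (cinner (app c \<xi>) e))\<^sup>2 + (cmod (cinner \<xi> e))\<^sup>2" for e
      using sum_squares_bound[of "cmod (cinner (app c \<xi>) e)" "cmod (cinner \<xi> e)"]
        mult_nonneg_nonneg[OF norm_ge_zero norm_ge_zero, of "cinner (app c \<xi>) e" "cinner \<xi> e"]
      unfolding f norm_mult complex_mod_cnj by linarith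
  qed
  from infsum_Re[OF this] show ?thesis
    using infsumI[OF parseval_inner[OF E, of "app c \<xi>" \<xi>]] by (simp only: tr_def f)
qed

text \<open>Put \<open>b = r * r\<close>. By duality the weight of \<open>T u\<close> is the real
  part of \<open>tr (S b * u)\<close>, and what is missing to the weight of \<open>u\<close> is its
  weight for the root \<open>q\<close> of \<open>b - S b\<close>, hence nonnegative. Splitting the
  trace needs convergence of both parts, which the Hilbert-Schmidt roots provide.\<close>

lemma weight_pre_adjoint_le:
  fixes T S :: "'a::complex_hilbert_space bop \<Rightarrow> 'a bop"
  assumes T: "positive_map T" and S: "pre_adjoint S T"
    and b: "r * r \<in> trace_class" "S (r * r) \<le> r * r"
    and E: "orthonormal_basis (some_onb :: 'a set)" and r: "adj r = r" "hs_on some_onb r"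
    and u: "0 \<le> u"
  shows "weight some_onb r (T u) \<le> weight some_onb r u"
proof -
  let ?b = "r * r"
  have trace: "Re (tr (q * q * v)) = weight some_onb q v"
    if "adj q = q" "hs_on some_onb q" for q v :: "'a bop"
    unfolding tr_def weight_def by (rule trace_square_mult(3)[OF E that])
  have S_tr: "tr (S ?b * v) = tr (?b * T v)" for v
    using S b(1) by (auto simp: pre_adjoint_def)
  \<comment> \<open>Self-adjointness is contained in \<open>S b \<le> b\<close>. By duality the form
    of \<open>S b\<close> at \<open>\<xi>\<close> is the weight of the positive operator
    \<open>T (rank_one \<xi>)\<close>.\<close>
  have Sb: "0 \<le> S ?b"
  proof -
    have "adj (?b - S ?b) = ?b - S ?b" using b(2) by (simp only: less_eq_bop_iff)
    then have "adj (S ?b) = S ?b" by (simp add: adj_diff adj_mult r(1))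
    moreover have "0 \<le> app (S ?b) \<xi> \<bullet> \<xi>" for \<xi>
    proof -
      have "app (S ?b) \<xi> \<bullet> \<xi> = weight some_onb r (T (rank_one \<xi>))"
        by (simp only: tr_mult_rank_one[OF E, symmetric] S_tr trace[OF r])
      moreover have "0 \<le> T (rank_one \<xi>)"
        using T rank_one_nonneg unfolding positive_map_def by blast
      ultimately show ?thesis by (simp add: weight_nonneg)
    qed
    ultimately show ?thesis by (simp add: nonneg_bop_iff)
  qed
  obtain p where p: "0 \<le> p" "p * p = S ?b" "hs_on some_onb p"
    using hs_sqrt_of_le[OF r Sb b(2)] by blast
  obtain q where q: "0 \<le> q" "q * q = ?b - S ?b" "hs_on some_onb q"
    using hs_sqrt_of_le[OF r, of "?b - S ?b"] b(2) Sb by (auto simp: diff_le_eq)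
  have "tr (?b * u) = tr (p * p * u) + tr (q * q * u)"
  proof -
    have "cinner (app (?b * u) e) e = cinner (app (p * p * u) e) e + cinner (app (q * q * u) e) e" for e
    proof -
      have "?b * u = p * p * u + q * q * u" unfolding p(2) q(2) by (simp add: left_diff_distrib)
      then show ?thesis by (simp only: app_ops cinner_add_left)
    qed
    then show ?thesis
      unfolding tr_def using trace_square_mult(1)[OF E adj_nonneg[OF p(1)] p(3), of u]
        trace_square_mult(1)[OF E adj_nonneg[OF q(1)] q(3), of u]
      by (simp only: infsum_add)
  qed
  then have "weight some_onb r u = weight some_onb r (T u) + weight some_onb q u"
    using S_tr[of u] trace[OF r, of u] trace[OF r, of "T u"] trace[OF adj_nonneg[OF q(1)] q(3), of u] p(2)
    by simp
  then show ?thesis using weight_nonneg[OF u, of some_onb q] by simp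
qed

theorem theorem7p1:
  fixes T S :: "'a::complex_hilbert_space bop \<Rightarrow> 'a bop" and b :: "'a bop"
  assumes "clinear T" and "positive_map T" and "T 1 = 1"
    and "pre_adjoint S T"
    and "b \<in> trace_class" and "0 \<le> b" and "inj (app b)" and "S b \<le> b"
  shows "((bij T \<and> positive_map (inv T)) \<longleftrightarrow> (bij T \<and> (\<forall>x. norm (T x) = norm x))) \<and>
         ((bij T \<and> (\<forall>x. norm (T x) = norm x)) \<longleftrightarrow> doubly_power_bounded T)"
proof -
  note T = assms(1-3)
  have inv1: "inv T 1 = 1" if "bij T"
    using that T(3) by (metis bij_is_inj inv_f_f)
  have a_b: "norm (T x) = norm x" if "bij T" "positive_map (inv T)" for x
  proof (rule antisym)
    show "norm (T x) \<le> norm x" by (rule positive_unital_norm_le[OF T])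
    show "norm x \<le> norm (T x)"
      using positive_unital_norm_le[OF clinear_inv[OF T(1) that(1)] that(2) inv1[OF that(1)], of "T x"]
        that(1) by (simp add: bij_is_inj)
  qed
  have b_a: "positive_map (inv T)" if "bij T" "\<forall>x. norm (T x) = norm x"
  proof (rule unital_contraction_positive[OF clinear_inv[OF T(1) that(1)] inv1[OF that(1)]])
    fix x
    have "norm (T (inv T x)) = norm (inv T x)" using that(2) by blast
    then show "norm (inv T x) \<le> norm x" using that(1) by (simp add: bij_is_surj surj_f_inv_f)
  qed
  have b_c: "doubly_power_bounded T" if "bij T" "\<forall>x. norm (T x) = norm x"
    using bij_isometry_doubly_power_bounded[OF T(1) that(1)] that(2) by blast
  have c_a: "positive_map (inv T)" if c: "doubly_power_bounded T"
  proof -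
    obtain r where r: "0 \<le> r" "r * r = b" "hs_on some_onb r"
      using trace_class_sqrt(2)[OF assms(5,6)] by blast
    have E: "orthonormal_basis (some_onb :: 'a set)" by (rule trace_class_sqrt(1)[OF assms(5,6)])
    have inj_r: "y = 0" if "app r y = 0" for y
    proof -
      have "app b y = app b 0" using that by (simp add: r(2)[symmetric])
      then show ?thesis using assms(7) by (simp only: inj_eq)
    qed
    obtain C where C: "\<And>n. onorm (int_iterate T n) \<le> C"
      using c by (auto simp: doubly_power_bounded_def bdd_above_def)
    have "norm ((inv T ^^ n) x) \<le> C * norm x" for n x
    proof -
      \<comment> \<open>For \<open>n = 0\<close> the other branch of \<open>int_iterate\<close>
        applies, and both branches give the identity.\<close>
      have it: "int_iterate T (- int n) = inv T ^^ n" by (simp add: int_iterate_def)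
      have "norm (int_iterate T (- int n) x) \<le> onorm (int_iterate T (- int n)) * norm x"
        using c by (intro onorm) (simp add: doubly_power_bounded_def)
      also have "\<dots> \<le> C * norm x" by (intro mult_right_mono C) simp
      finally show ?thesis unfolding it .
    qed
    moreover have "weight some_onb r (T u) \<le> weight some_onb r u" if "0 \<le> u" for u
      using weight_pre_adjoint_le[OF T(2) assms(4) _ _ E adj_nonneg[OF r(1)] r(3) that] assms(5,8) r(2)
      by simp
    ultimately show ?thesis
      using c by (intro inv_positive_of_power_bounded[OF E adj_nonneg[OF r(1)] r(3) inj_r T(1,2)])
        (auto simp: doubly_power_bounded_def)
  qed
  have "bij T" if "doubly_power_bounded T" using that by (simp add: doubly_power_bounded_def)
  then show ?thesis using a_b b_a b_c c_a by blast
qed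

end
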